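(* Let $\tau>0$ and let $E,A,B\in\mathbb{C}^{n,n}$ be pairwise commuting with $(E,A,B)$ regular (i.e. $\det(\lambda E-A-\omega B)\not\equiv0$), and suppose the DDAE $E\dot x(t)=Ax(t)+Bx(t-\tau)+f(t)$, $t\ge0$, $x|_{[-\tau,0]}=\varphi$, is already in the form $E=\mathrm{diag}(J^E,N^E_2,N^E_3)$, $A=\mathrm{diag}(A_1,J^A,N^A_3)$, $B=\mathrm{diag}(B_1,B_2,J^B)$ with $J^E,J^A,J^B$ nonsingular and $N^E_2,N^E_3,N^A_3$ nilpotent, where $x=(x_1,x_2,x_3)$, $f=(f_1,f_2,f_3)$, $\varphi=(\varphi_1,\varphi_2,\varphi_3)$ are partitioned conformably and $n_3$ is the size of the third block. Assume the corresponding IVP is uniquely solvable and that $\varphi$ and $f$ are sufficiently smooth. Set $\tilde A_1=(J^E)^{-1}A_1$, $\tilde B_1=(J^E)^{-1}B_1$, $\tilde f_1=(J^E)^{-1}f_1$, $\hat B_1=e^{-\tilde A_1\tau}\tilde B_1$, $\tilde N^E_2=(J^A)^{-1}N^E_2$, $\tilde B_2=(J^A)^{-1}B_2$, $\tilde f_2=(J^A)^{-1}f_2$, $\tilde N^E_3=(J^B)^{-1}N^E_3$, $\tilde N^A_3=(J^B)^{-1}N^A_3$, $\tilde f_3=(J^B)^{-1}f_3$, and let $\zeta$ be the nilpotency index of $\tilde N^E_2$. Then the solution satisfies, for all $t\ge0$, $$x_1(t)=e^{\tilde A_1t}e_\tau^{\hat B_1(t-\tau)}\varphi_1(0)+\int_{-\tau}^0e^{\tilde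 A_1(t-s)}e_\tau^{\hat B_1(t-2\tau-s)}\hat B_1\varphi_1(s)\,ds+\int_0^te^{\tilde A_1(t-s)}e_\tau^{\hat B_1(t-\tau-s)}\tilde f_1(s)\,ds,$$ $$x_2(t)=-\sum_{i=0}^{\zeta-1}(\tilde N^E_2)^i\Big(\tilde B_2x_2^{(i)}(t-\tau)+\tilde f_2^{(i)}(t)\Big),\qquad x_3(t)=-\sum_{i=0}^{n_3-1}\Big(\tilde N^E_3\tfrac{d}{dt}-\tilde N^A_3\Big)^i\tilde f_3\big(t+(i+1)\tau\big).$$
   Context: For a square matrix $D$, the delay matrix exponential is $e^{Dt}_\tau=0$ for $t<-\tau$, $e^{Dt}_\tau=I$ for $-\tau\le t\le0$, and $e^{Dt}_\tau=I+Dt+\frac{D^2}{2!}(t-\tau)^2+\dots+\frac{D^k}{k!}(t-(k-1)\tau)^k$ for $(k-1)\tau\le t\le k\tau$, $k=1,2,\dots$. Solutions are piecewise differentiable: continuous $x$ with $Ex$ piecewise continuously differentiable satisfying the equation for all $t\in[0,\infty)\setminus\bigcup_{j\in\mathbb{N}_0}\{j\tau\}$. *)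

theory Defs
  imports "HOL-Analysis.Analysis"
begin

section \<open>Matrix notions for type-indexed complex matrices\<close>

definition mpow :: "'a::semiring_1^'n^'n \<Rightarrow> nat \<Rightarrow> 'a^'n^'n" where
  "mpow M k = (((**) M) ^^ k) (mat 1)"

definition nilpotent_mat :: "'a::semiring_1^'n^'n \<Rightarrow> bool" where
  "nilpotent_mat M \<longleftrightarrow> (\<exists>k. mpow M k = 0)"

definition nilpotency_index :: "'a::semiring_1^'n^'n \<Rightarrow> nat" where
  "nilpotency_index M = (LEAST k. mpow M k = 0)"

text \<open>Matrix exponential e^M as the power series.\<close>
definition mexp :: "complex^'n^'n \<Rightarrow> complex^'n^'n" where
  "mexp M = (\<Sum>k. (1 / fact k) *\<^sub>R mpow M k)"

text \<open>Delay matrix exponential e_tau^{D t}.\<close>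
definition delay_exp :: "real \<Rightarrow> complex^'n^'n \<Rightarrow> real \<Rightarrow> complex^'n^'n" where
  "delay_exp \<tau> D t =
     (if t < - \<tau> then 0
      else if t \<le> 0 then mat 1
      else (\<Sum>j\<le>nat \<lceil>t / \<tau>\<rceil>.
              ((t - (real j - 1) * \<tau>) ^ j / fact j) *\<^sub>R mpow D j))"

section \<open>Block structure\<close>

definition blkdiag3 :: "'r::zero^'a^'a \<Rightarrow> 'r^'b^'b \<Rightarrow> 'r^'c^'c \<Rightarrow> 'r^('a+'b+'c)^('a+'b+'c)" where
  "blkdiag3 M1 M2 M3 = (\<chi> i j. case (i, j) of
      (Inl p, Inl q) \<Rightarrow> M1 $ p $ q
    | (Inr (Inl p), Inr (Inl q)) \<Rightarrow> M2 $ p $ q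
    | (Inr (Inr p), Inr (Inr q)) \<Rightarrow> M3 $ p $ q
    | _ \<Rightarrow> 0)"

definition blk1 :: "'r^('a::finite+'b::finite+'c::finite) \<Rightarrow> 'r^'a" where "blk1 v = (\<chi> i. v $ Inl i)"
definition blk2 :: "'r^('a::finite+'b::finite+'c::finite) \<Rightarrow> 'r^'b" where "blk2 v = (\<chi> i. v $ Inr (Inl i))"
definition blk3 :: "'r^('a::finite+'b::finite+'c::finite) \<Rightarrow> 'r^'c" where "blk3 v = (\<chi> i. v $ Inr (Inr i))"

section \<open>Regularity of a matrix triple\<close>

definition regular_triple :: "complex^'n^'n \<Rightarrow> complex^'n^'n \<Rightarrow> complex^'n^'n \<Rightarrow> bool" where
  "regular_triple E A B \<longleftrightarrow>
     (\<exists>l w::complex. det (\<chi> i j. l * E$i$j - A$i$j - w * B$i$j) \<noteq> 0)"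

section \<open>Derivatives\<close>

text \<open>Iterated (two-sided) derivative.\<close>
fun nderiv :: "nat \<Rightarrow> (real \<Rightarrow> 'v::real_normed_vector) \<Rightarrow> real \<Rightarrow> 'v" where
  "nderiv 0 g = g"
| "nderiv (Suc k) g = (\<lambda>t. vector_derivative (nderiv k g) (at t))"

text \<open>Iterated right derivative (used for the piecewise smooth solution component).\<close>
fun rderiv :: "nat \<Rightarrow> (real \<Rightarrow> 'v::real_normed_vector) \<Rightarrow> real \<Rightarrow> 'v" where
  "rderiv 0 g = g"
| "rderiv (Suc k) g = (\<lambda>t. vector_derivative (rderiv k g) (at t within {t..}))"

definition smooth_fun :: "(real \<Rightarrow> 'v::real_normed_vector) \<Rightarrow> bool" where
  "smooth_fun g \<longleftrightarrow> (\<forall>k t. (nderiv k g has_vector_derivative nderiv (Suc k) g t) (at t))"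

section \<open>Solutions of the DDAE  E x' = A x + B x(t-tau) + f,  x = phi on [-tau,0]\<close>

definition ddae_solution ::
  "complex^'n^'n \<Rightarrow> complex^'n^'n \<Rightarrow> complex^'n^'n \<Rightarrow> real \<Rightarrow>
   (real \<Rightarrow> complex^'n) \<Rightarrow> (real \<Rightarrow> complex^'n) \<Rightarrow> (real \<Rightarrow> complex^'n) \<Rightarrow> bool" where
  "ddae_solution E A B \<tau> f \<phi> x \<longleftrightarrow>
     continuous_on {-\<tau>..} x \<and>
     (\<forall>t\<in>{-\<tau>..0}. x t = \<phi> t) \<and>
     (\<forall>j::nat. \<exists>g. continuous_on {real j * \<tau> .. (real j + 1) * \<tau>} g \<and>
        (\<forall>t\<in>{real j * \<tau> <..< (real j + 1) * \<tau>}.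
            ((\<lambda>s. E *v x s) has_vector_derivative g t) (at t))) \<and>
     (\<forall>t\<ge>0. (\<forall>j::nat. t \<noteq> real j * \<tau>) \<longrightarrow>
        ((\<lambda>s. E *v x s) has_vector_derivative (A *v x t + B *v x (t - \<tau>) + f t)) (at t))"

definition uniquely_solvable ::
  "complex^'n^'n \<Rightarrow> complex^'n^'n \<Rightarrow> complex^'n^'n \<Rightarrow> real \<Rightarrow>
   (real \<Rightarrow> complex^'n) \<Rightarrow> (real \<Rightarrow> complex^'n) \<Rightarrow> bool" where
  "uniquely_solvable E A B \<tau> f \<phi> \<longleftrightarrow>
     (\<exists>x. ddae_solution E A B \<tau> f \<phi> x \<and>
          (\<forall>y. ddae_solution E A B \<tau> f \<phi> y \<longrightarrow> (\<forall>t\<ge>-\<tau>. y t = x t)))"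

end

theory Submission
  imports Defs
begin

text \<open>The three blocks decouple; after multiplication by the inverse of its invertible
  coefficient, each block is solved separately.

  The third block \<open>P x' = Q x + x(t - \<tau>) + f\<close>, with \<open>P\<close>, \<open>Q\<close> commuting and nilpotent, is
  algebraic: the operator \<open>L g = P g' - Q g\<close> is nilpotent on smooth functions, because all
  products of \<open>n\<close> factors taken from \<open>P\<close> and \<open>Q\<close> vanish. Hence \<open>x + \<Sum>\<^sub>i (L\<^sup>i f)(t + (i + 1)\<tau>)\<close>
  solves \<open>P e' = Q e + e(t - \<tau>)\<close>, and this homogeneous equation only has the trivial solution.

  In the second block \<open>N x' = x + B x(t - \<tau>) + f\<close>, with \<open>N\<close> nilpotent, the only continuous
  solution of \<open>N y' = y + h\<close> on an interval is \<open>y = -\<Sum>\<^sub>i N\<^sup>i h\<^sup>(\<^sup>i\<^sup>)\<close>; stepping from one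
  interval \<open>[j\<tau>, (j + 1)\<tau>]\<close> to the next, with the delayed term already known, gives the formula.

  In the first block \<open>x' = A x + B x(t - \<tau>) + f\<close> the substitution \<open>u(t) = e\<^sup>-\<^sup>A\<^sup>t x(t)\<close> leads to
  the pure delay equation \<open>u' = e\<^sup>-\<^sup>A\<^sup>\<tau> B u(t - \<tau>) + e\<^sup>-\<^sup>A\<^sup>t f(t)\<close>. On bounded intervals the delay
  exponential is a finite sum of truncated powers, so the candidate solution can be differentiated
  term by term, and the method of steps shows that it is the only solution.\<close>

section \<open>Matrices and the matrix exponential\<close>

lemma scaleR_matrix_vector_left:
  "((c::real) *\<^sub>R M) *v v = c *\<^sub>R (M *v (v::'a::real_algebra_1^'n))"
  by (simp add: vec_eq_iff matrix_vector_mult_def scaleR_sum_right)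

lemma scaleR_matrix_vector_right:
  "M *v ((c::real) *\<^sub>R (v::'a::real_algebra_1^'n)) = c *\<^sub>R (M *v v)"
  by (simp add: vec_eq_iff matrix_vector_mult_def scaleR_sum_right)

lemma matrix_add_rdistrib: "((A::'a::semiring_1^'n^'m) + B) ** C = A ** C + B ** C"
  by (simp add: vec_eq_iff matrix_matrix_mult_def sum.distrib distrib_right)

lemma sum_matrix_mult_left: "(\<Sum>j\<in>S. P j) ** (M::'a::semiring_1^'n^'m) = (\<Sum>j\<in>S. P j ** M)"
  by (induction S rule: infinite_finite_induct) (simp_all add: matrix_add_rdistrib)

lemma sum_matrix_mult_right: "(M::'a::semiring_1^'n^'m) ** (\<Sum>j\<in>S. P j) = (\<Sum>j\<in>S. M ** P j)"
  by (induction S rule: infinite_finite_induct) (simp_all add: matrix_add_ldistrib)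

lemma sum_matrix_vector_mult_left: "(\<Sum>j\<in>S. P j) *v (v::'a::semiring_1^'n) = (\<Sum>j\<in>S. P j *v v)"
  by (induction S rule: infinite_finite_induct) (simp_all add: matrix_vector_mult_add_rdistrib)

lemma matrix_vector_mult_uminus_left: "(- A) *v x = - (A *v (x::'a::ring_1^'n))"
  by (simp add: vec_eq_iff matrix_vector_mult_def sum_negf)

lemma
  assumes "invertible (M::'a::semiring_1^'n^'n)"
  shows matrix_inv_left: "matrix_inv M ** M = mat 1" and matrix_inv_right: "M ** matrix_inv M = mat 1"
  using someI_ex[OF assms[unfolded invertible_def]] by (simp_all add: matrix_inv_def)

lemma matrix_inv_commute:
  assumes "invertible J" "J ** N = N ** (J::complex^'n::finite^'n)"
  shows "matrix_inv J ** N = N ** matrix_inv J"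
proof -
  have "matrix_inv J ** N = matrix_inv J ** (N ** J) ** matrix_inv J"
    by (simp add: matrix_mul_assoc[symmetric] matrix_inv_right[OF assms(1)])
  also have "\<dots> = N ** matrix_inv J"
    by (simp add: assms(2)[symmetric] matrix_mul_assoc matrix_inv_left[OF assms(1)])
  finally show ?thesis .
qed

lemma matrix_inv_mult_commute:
  assumes J: "invertible J" and JM: "J ** M = M ** J" and JN: "J ** N = N ** J"
    and MN: "M ** N = N ** (M::complex^'n::finite^'n)"
  shows "(matrix_inv J ** M) ** (matrix_inv J ** N) = (matrix_inv J ** N) ** (matrix_inv J ** M)"
proof -
  have "(matrix_inv J ** M) ** (matrix_inv J ** N) = matrix_inv J ** matrix_inv J ** (M ** N)"
    using matrix_inv_commute[OF J JM] by (metis matrix_mul_assoc)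
  also have "\<dots> = (matrix_inv J ** N) ** (matrix_inv J ** M)"
    using matrix_inv_commute[OF J JN] MN by (metis matrix_mul_assoc)
  finally show ?thesis .
qed

lemma bounded_bilinear_matrix_vector_mult:
  "bounded_bilinear ((*v) :: complex^'n::finite^'m::finite \<Rightarrow> complex^'n \<Rightarrow> complex^'m)"
proof -
  have "bilinear ((*v) :: complex^'n^'m \<Rightarrow> complex^'n \<Rightarrow> complex^'m)"
    unfolding bilinear_def
    by (auto intro!: linearI simp: matrix_vector_mult_add_rdistrib matrix_vector_right_distrib
        scaleR_matrix_vector_left scaleR_matrix_vector_right)
  then show ?thesis by (simp add: bilinear_conv_bounded_bilinear)
qed

lemma matrix_component_le_onorm_complex:
  "norm (M $ i $ j) \<le> onorm ((*v) (M::complex^'n::finite^'m::finite))"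
proof -
  have "norm (M $ i $ j) = norm ((M *v axis j 1) $ i)"
    by (simp add: matrix_vector_mult_def axis_def if_distrib cong: if_cong)
  also have "\<dots> \<le> norm (M *v axis j 1)" by (rule Finite_Cartesian_Product.norm_nth_le)
  also have "\<dots> \<le> onorm ((*v) M) * norm (axis j (1::complex))" by (rule onorm) simp
  finally show ?thesis by (simp add: norm_axis_1)
qed

lemma norm_le_onorm_complex:
  "norm (M::complex^'n::finite^'m::finite) \<le> real CARD('m) * real CARD('n) * onorm ((*v) M)"
proof -
  have "norm M \<le> (\<Sum>i\<in>UNIV. \<Sum>j\<in>UNIV. norm (M $ i $ j))"
    unfolding norm_vec_def
    by (rule order.trans[OF L2_set_le_sum sum_mono]) (auto intro: L2_set_le_sum)
  also have "\<dots> \<le> (\<Sum>i\<in>(UNIV::'m set). \<Sum>j\<in>(UNIV::'n set). onorm ((*v) M))"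
    by (intro sum_mono matrix_component_le_onorm_complex)
  finally show ?thesis by simp
qed

text \<open>Square complex matrices with the operator norm form a real Banach algebra, and \<^const>\<open>mexp\<close>
  is its exponential. The algebra is a copy of \<open>complex^'n^'n\<close>, because that type already
  carries the Euclidean norm, for which \<open>norm (mat 1) = sqrt CARD('n)\<close>.\<close>

typedef ('n::finite) cmat = "UNIV :: (complex^'n^'n) set" by auto

setup_lifting type_definition_cmat

instantiation cmat :: (finite) "{real_vector, ring_1}"
begin
lift_definition zero_cmat :: "'a cmat" is "0" .
lift_definition one_cmat :: "'a cmat" is "mat 1" .
lift_definition plus_cmat :: "'a cmat \<Rightarrow> 'a cmat \<Rightarrow> 'a cmat" is "(+)" .
lift_definition minus_cmat :: "'a cmat \<Rightarrow> 'a cmat \<Rightarrow> 'a cmat" is "(-)" .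
lift_definition uminus_cmat :: "'a cmat \<Rightarrow> 'a cmat" is "uminus" .
lift_definition times_cmat :: "'a cmat \<Rightarrow> 'a cmat \<Rightarrow> 'a cmat" is "(**)" .
lift_definition scaleR_cmat :: "real \<Rightarrow> 'a cmat \<Rightarrow> 'a cmat" is "scaleR" .
instance
proof
  show "a + b + c = a + (b + c)" for a b c :: "'a cmat" by transfer (simp add: algebra_simps)
  show "a + b = b + a" for a b :: "'a cmat" by transfer (simp add: algebra_simps)
  show "0 + a = a" for a :: "'a cmat" by transfer simp
  show "- a + a = 0" for a :: "'a cmat" by transfer simp
  show "a - b = a + - b" for a b :: "'a cmat" by transfer simp
  show "r *\<^sub>R (a + b) = r *\<^sub>R a + r *\<^sub>R b" for r and a b :: "'a cmat"
    by transfer (simp add: scaleR_right_distrib)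
  show "(r + s) *\<^sub>R a = r *\<^sub>R a + s *\<^sub>R a" for r s and a :: "'a cmat"
    by transfer (simp add: scaleR_left_distrib)
  show "r *\<^sub>R s *\<^sub>R a = (r * s) *\<^sub>R a" for r s and a :: "'a cmat" by transfer simp
  show "1 *\<^sub>R a = a" for a :: "'a cmat" by transfer simp
  show "a * b * c = a * (b * c)" for a b c :: "'a cmat" by transfer (simp add: matrix_mul_assoc)
  show "1 * a = a" for a :: "'a cmat" by transfer simp
  show "a * 1 = a" for a :: "'a cmat" by transfer simp
  show "(a + b) * c = a * c + b * c" for a b c :: "'a cmat"
    by transfer (simp add: vec_eq_iff matrix_matrix_mult_def sum.distrib distrib_right)
  show "a * (b + c) = a * b + a * c" for a b c :: "'a cmat" by transfer (simp add: matrix_add_ldistrib)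
  show "(0::'a cmat) \<noteq> 1" by transfer (simp add: vec_eq_iff mat_def)
qed
end

instance cmat :: (finite) real_algebra_1
proof
  show "r *\<^sub>R a * b = r *\<^sub>R (a * b)" for r and a b :: "'a cmat"
    by transfer (simp add: scalar_matrix_assoc)
  show "a * r *\<^sub>R b = r *\<^sub>R (a * b)" for r and a b :: "'a cmat"
    by transfer (simp add: matrix_scalar_ac scalar_matrix_assoc)
qed

instantiation cmat :: (finite) real_normed_vector
begin
lift_definition norm_cmat :: "'a cmat \<Rightarrow> real" is "\<lambda>M. onorm ((*v) M)" .
definition dist_cmat :: "'a cmat \<Rightarrow> 'a cmat \<Rightarrow> real" where "dist_cmat x y = norm (x - y)"
definition sgn_cmat :: "'a cmat \<Rightarrow> 'a cmat" where "sgn_cmat x = x /\<^sub>R norm x"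
definition uniformity_cmat :: "('a cmat \<times> 'a cmat) filter" where
  "uniformity_cmat = (INF e\<in>{0<..}. principal {(x, y). dist x y < e})"
definition open_cmat :: "'a cmat set \<Rightarrow> bool" where
  "open_cmat U = (\<forall>x\<in>U. \<forall>\<^sub>F (x', y) in uniformity. x' = x \<longrightarrow> y \<in> U)"
instance
proof
  show "norm (x + y) \<le> norm x + norm y" for x y :: "'a cmat"
  proof transfer
    fix x y :: "complex^'a^'a"
    have "(*v) (x + y) = (\<lambda>v. x *v v + y *v v)"
      by (rule ext) (simp add: matrix_vector_mult_add_rdistrib)
    then show "onorm ((*v) (x + y)) \<le> onorm ((*v) x) + onorm ((*v) y)"
      using onorm_triangle[of "(*v) x" "(*v) y"] by simp
  qed
  show "norm (r *\<^sub>R x) = \<bar>r\<bar> * norm x" for r and x :: "'a cmat"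
  proof transfer
    fix r and x :: "complex^'a^'a"
    have "(*v) (r *\<^sub>R x) = (\<lambda>v. r *\<^sub>R (x *v v))" by (rule ext) (simp add: scaleR_matrix_vector_left)
    then show "onorm ((*v) (r *\<^sub>R x)) = \<bar>r\<bar> * onorm ((*v) x)"
      using onorm_scaleR[of "(*v) x" r] by simp
  qed
  show "(norm x = 0) = (x = 0)" for x :: "'a cmat"
    by transfer (simp add: onorm_eq_0 matrix_eq[of _ 0])
qed (simp_all add: dist_cmat_def sgn_cmat_def uniformity_cmat_def open_cmat_def)
end

instance cmat :: (finite) real_normed_algebra_1
proof
  show "norm (x * y) \<le> norm x * norm y" for x y :: "'a cmat"
  proof transfer
    fix x y :: "complex^'a^'a"
    have "onorm ((*v) (x ** y)) = onorm ((*v) x \<circ> (*v) y)"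
      by (simp add: o_def matrix_vector_mul_assoc)
    also have "\<dots> \<le> onorm ((*v) x) * onorm ((*v) y)" by (rule onorm_compose) auto
    finally show "onorm ((*v) (x ** y)) \<le> onorm ((*v) x) * onorm ((*v) y)" .
  qed
  show "norm (1::'a cmat) = 1"
    by transfer (simp add: onorm_id[unfolded id_def] matrix_vector_mul_lid[abs_def])
qed

lemma bounded_linear_Rep_cmat: "bounded_linear (Rep_cmat :: 'a::finite cmat \<Rightarrow> _)"
proof (rule bounded_linear_intro[where K = "real CARD('a) * real CARD('a)"])
  show "norm (Rep_cmat x) \<le> norm x * (real CARD('a) * real CARD('a))" for x :: "'a cmat"
    using norm_le_onorm_complex[of "Rep_cmat x"] by (simp add: norm_cmat.rep_eq mult.commute)
qed (transfer; simp)+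

lemma bounded_linear_Abs_cmat: "bounded_linear (Abs_cmat :: complex^'a::finite^'a \<Rightarrow> _)"
proof -
  obtain K where K: "\<And>(M::complex^'a^'a) v. norm (M *v v) \<le> norm M * norm v * K" "K > 0"
    using bounded_bilinear.pos_bounded[OF bounded_bilinear_matrix_vector_mult] by blast
  show ?thesis
  proof (rule bounded_linear_intro[where K = K])
    show "norm (Abs_cmat M) \<le> norm M * K" for M :: "complex^'a^'a"
      unfolding norm_cmat.rep_eq Abs_cmat_inverse[OF UNIV_I]
      by (rule onorm_le) (use K(1) in \<open>simp add: mult.commute mult.left_commute\<close>)
  qed (metis Abs_cmat_inverse UNIV_I plus_cmat.rep_eq Rep_cmat_inverse,
       metis Abs_cmat_inverse UNIV_I scaleR_cmat.rep_eq Rep_cmat_inverse)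
qed

instance cmat :: (finite) banach
proof
  fix X :: "nat \<Rightarrow> 'a cmat"
  assume "Cauchy X"
  then have "Cauchy (\<lambda>n. Rep_cmat (X n))"
    by (rule bounded_linear.Cauchy[OF bounded_linear_Rep_cmat])
  then obtain L where "(\<lambda>n. Rep_cmat (X n)) \<longlonglongrightarrow> L"
    by (auto simp: Cauchy_convergent_iff convergent_def)
  then have "(\<lambda>n. Abs_cmat (Rep_cmat (X n))) \<longlonglongrightarrow> Abs_cmat L"
    by (rule bounded_linear.tendsto[OF bounded_linear_Abs_cmat])
  then show "convergent X" by (auto simp: Rep_cmat_inverse convergent_def)
qed

lemma Rep_cmat_times: "Rep_cmat (X * Y) = Rep_cmat X ** Rep_cmat Y" by transfer simp
lemma Rep_cmat_one: "Rep_cmat 1 = mat 1" by transfer simp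
lemma Abs_cmat_times: "Abs_cmat (M ** N) = Abs_cmat M * Abs_cmat N"
  by (metis Abs_cmat_inverse Rep_cmat_inverse Rep_cmat_times UNIV_I)
lemma Abs_cmat_scaleR: "Abs_cmat (c *\<^sub>R M) = c *\<^sub>R Abs_cmat M"
  by (metis Abs_cmat_inverse UNIV_I scaleR_cmat.rep_eq Rep_cmat_inverse)
lemma Abs_cmat_zero: "Abs_cmat 0 = 0"
  by (metis Abs_cmat_inverse UNIV_I zero_cmat.rep_eq Rep_cmat_inverse)
lemma Rep_cmat_Abs_cmat [simp]: "Rep_cmat (Abs_cmat M) = M"
  by (simp add: Abs_cmat_inverse)

lemma mpow_Suc: "mpow M (Suc k) = M ** mpow M k" by (simp add: mpow_def)
lemma mpow_0 [simp]: "mpow M 0 = mat 1" by (simp add: mpow_def)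

lemma mpow_eq_power: "mpow (M::complex^'n::finite^'n) k = Rep_cmat (Abs_cmat M ^ k)"
  by (induction k) (simp_all add: mpow_Suc Rep_cmat_times Rep_cmat_one)

lemma mexp_eq_exp: "mexp (M::complex^'n::finite^'n) = Rep_cmat (exp (Abs_cmat M))"
proof -
  have "(\<lambda>k. Rep_cmat (Abs_cmat M ^ k /\<^sub>R fact k)) sums Rep_cmat (exp (Abs_cmat M))"
    by (rule bounded_linear.sums[OF bounded_linear_Rep_cmat exp_converges])
  then show ?thesis
    by (simp add: mexp_def sums_iff mpow_eq_power scaleR_cmat.rep_eq divide_inverse)
qed

lemma mpow_add: "mpow (M::complex^'n::finite^'n) (a + b) = mpow M a ** mpow M b"
  by (simp add: mpow_eq_power power_add Rep_cmat_times)

lemma mpow_commute: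
  "M ** N = N ** M \<Longrightarrow> mpow (M::complex^'n::finite^'n) k ** N = N ** mpow M k"
  by (induction k) (simp_all add: mpow_Suc matrix_mul_assoc[symmetric], metis matrix_mul_assoc)

lemma mpow_mult_commuting:
  assumes "M ** N = N ** M"
  shows "mpow ((M::complex^'n::finite^'n) ** N) k = mpow M k ** mpow N k"
proof (induction k)
  case (Suc k)
  have "mpow (M ** N) (Suc k) = M ** (N ** mpow M k) ** mpow N k"
    using Suc by (simp add: mpow_Suc matrix_mul_assoc)
  also have "\<dots> = M ** (mpow M k ** N) ** mpow N k"
    by (simp add: mpow_commute[OF assms])
  also have "\<dots> = mpow M (Suc k) ** mpow N (Suc k)"
    by (simp add: mpow_Suc matrix_mul_assoc)
  finally show ?case .
qed simp

lemma exp_commute: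
  fixes x y :: "'a::{real_normed_algebra_1,banach}"
  assumes "x * y = y * x"
  shows "exp x * y = y * exp x"
proof -
  have "exp x * y = (\<Sum>n. x ^ n /\<^sub>R fact n * y)"
    by (simp add: exp_def suminf_mult2 summable_exp_generic)
  also have "\<dots> = (\<Sum>n. y * (x ^ n /\<^sub>R fact n))"
    by (simp add: power_commuting_commutes[OF assms])
  also have "\<dots> = y * exp x"
    using suminf_mult[OF summable_exp_generic[of x], of y] by (simp add: exp_def)
  finally show ?thesis .
qed

lemma mexp_add:
  "mexp (s *\<^sub>R A) ** mexp (t *\<^sub>R A) = mexp ((s + t) *\<^sub>R (A::complex^'n::finite^'n))"
proof -
  have "exp (s *\<^sub>R Abs_cmat A) * exp (t *\<^sub>R Abs_cmat A) = exp ((s + t) *\<^sub>R Abs_cmat A)"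
    by (simp add: exp_add_commuting[symmetric] scaleR_left_distrib)
  then show ?thesis by (simp add: mexp_eq_exp Abs_cmat_scaleR Rep_cmat_times[symmetric])
qed

lemma mexp_zero: "mexp (0::complex^'n::finite^'n) = mat 1"
  by (simp add: mexp_eq_exp Abs_cmat_zero Rep_cmat_one)

lemma mexp_commute:
  assumes "A ** B = B ** A"
  shows "mexp (t *\<^sub>R A) ** B = B ** mexp (t *\<^sub>R (A::complex^'n::finite^'n))"
proof -
  have "(t *\<^sub>R Abs_cmat A) * Abs_cmat B = Abs_cmat B * (t *\<^sub>R Abs_cmat A)"
    using assms by (simp add: Abs_cmat_times[symmetric])
  then have "exp (t *\<^sub>R Abs_cmat A) * Abs_cmat B = Abs_cmat B * exp (t *\<^sub>R Abs_cmat A)"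
    by (rule exp_commute)
  then show ?thesis
    by (metis mexp_eq_exp Abs_cmat_scaleR Rep_cmat_times Rep_cmat_Abs_cmat)
qed

lemma has_vector_derivative_mexp:
  "((\<lambda>t. mexp (t *\<^sub>R A)) has_vector_derivative mexp (t *\<^sub>R A) ** A) (at t within S)"
  for A :: "complex^'n::finite^'n"
  using bounded_linear.has_vector_derivative[OF bounded_linear_Rep_cmat
      exp_scaleR_has_vector_derivative_right[of "Abs_cmat A"]]
  by (simp add: mexp_eq_exp Abs_cmat_scaleR Rep_cmat_times)

section \<open>Smooth functions\<close>

declare nderiv.simps(2) [simp del] rderiv.simps(2) [simp del]

lemma nderiv_by_derivatives:
  assumes "F 0 = g" and "\<And>k t. (F k has_vector_derivative F (Suc k) t) (at t)"
  shows "nderiv k g = F k"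
proof (induction k)
  case (Suc k)
  show ?case
    unfolding nderiv.simps(2) Suc by (rule ext) (rule vector_derivative_at[OF assms(2)])
qed (simp add: assms(1))

lemma smooth_funI_derivatives:
  assumes "F 0 = g" and "\<And>k t. (F k has_vector_derivative F (Suc k) t) (at t)"
  shows "smooth_fun g"
  unfolding smooth_fun_def nderiv_by_derivatives[OF assms] using assms(2) by blast

lemma smooth_fun_has_vector_derivative:
  "smooth_fun g \<Longrightarrow> (nderiv k g has_vector_derivative nderiv (Suc k) g t) (at t)"
  unfolding smooth_fun_def by blast

lemma smooth_fun_has_vector_derivative_0:
  "smooth_fun g \<Longrightarrow> (g has_vector_derivative nderiv 1 g t) (at t)"
  using smooth_fun_has_vector_derivative[of g 0] by simp

lemma smooth_fun_continuous_on: "smooth_fun g \<Longrightarrow> continuous_on S g"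
  by (meson continuous_at_imp_continuous_on has_vector_derivative_continuous
      smooth_fun_has_vector_derivative_0)

lemma nderiv_nderiv: "smooth_fun g \<Longrightarrow> nderiv k (nderiv i g) = nderiv (k + i) g"
  by (rule nderiv_by_derivatives) (simp_all add: smooth_fun_has_vector_derivative)

lemma smooth_fun_nderiv: "smooth_fun g \<Longrightarrow> smooth_fun (nderiv i g)"
  by (rule smooth_funI_derivatives[where F = "\<lambda>k. nderiv (k + i) g"])
    (simp_all add: smooth_fun_has_vector_derivative)

context
  fixes L :: "'a::real_normed_vector \<Rightarrow> 'b::real_normed_vector"
  assumes L: "bounded_linear L"
begin

lemma nderiv_bounded_linear:
  "smooth_fun g \<Longrightarrow> nderiv k (\<lambda>t. L (g t)) = (\<lambda>t. L (nderiv k g t))"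
  by (rule nderiv_by_derivatives) (auto intro: bounded_linear.has_vector_derivative[OF L]
      smooth_fun_has_vector_derivative)

lemma smooth_fun_bounded_linear: "smooth_fun g \<Longrightarrow> smooth_fun (\<lambda>t. L (g t))"
  by (rule smooth_funI_derivatives[where F = "\<lambda>k t. L (nderiv k g t)"])
    (auto intro: bounded_linear.has_vector_derivative[OF L] smooth_fun_has_vector_derivative)

end

lemma nderiv_matrix_vector_mult:
  "smooth_fun g \<Longrightarrow> nderiv k (\<lambda>t. (M::complex^'n^'m) *v g t) = (\<lambda>t. M *v nderiv k g t)"
  by (rule nderiv_bounded_linear) auto

lemma smooth_fun_matrix_vector_mult:
  "smooth_fun g \<Longrightarrow> smooth_fun (\<lambda>t. (M::complex^'n^'m) *v g t)"
  by (rule smooth_fun_bounded_linear) auto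

lemma smooth_fun_uminus: "smooth_fun g \<Longrightarrow> smooth_fun (\<lambda>t. - g t)"
  by (rule smooth_fun_bounded_linear[OF bounded_linear_minus[OF bounded_linear_ident]])

lemma
  assumes "smooth_fun g" "smooth_fun h"
  shows nderiv_add: "nderiv k (\<lambda>t. g t + h t) = (\<lambda>t. nderiv k g t + nderiv k h t)"
    and smooth_fun_add: "smooth_fun (\<lambda>t. g t + h t)"
  by (rule nderiv_by_derivatives smooth_funI_derivatives[where F = "\<lambda>k t. nderiv k g t + nderiv k h t"];
      simp add: has_vector_derivative_add smooth_fun_has_vector_derivative assms)+

lemma smooth_fun_diff: "smooth_fun g \<Longrightarrow> smooth_fun h \<Longrightarrow> smooth_fun (\<lambda>t. g t - h t)"
  by (rule smooth_funI_derivatives[where F = "\<lambda>k t. nderiv k g t - nderiv k h t"])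
    (simp_all add: has_vector_derivative_diff smooth_fun_has_vector_derivative)

lemma
  assumes "\<And>i. i \<in> I \<Longrightarrow> smooth_fun (g i)"
  shows nderiv_sum: "nderiv k (\<lambda>t. \<Sum>i\<in>I. g i t) = (\<lambda>t. \<Sum>i\<in>I. nderiv k (g i) t)"
    and smooth_fun_sum: "smooth_fun (\<lambda>t. \<Sum>i\<in>I. g i t)"
  by (rule nderiv_by_derivatives smooth_funI_derivatives[where F = "\<lambda>k t. \<Sum>i\<in>I. nderiv k (g i) t"];
      simp add: has_vector_derivative_sum smooth_fun_has_vector_derivative assms)+

lemma has_vector_derivative_shift:
  "(f has_vector_derivative f') (at (t + c)) \<Longrightarrow> ((\<lambda>t. f (t + c)) has_vector_derivative f') (at t)"
proof -
  have "((\<lambda>t. t + c) has_vector_derivative 1) (at t)" by (auto intro!: derivative_eq_intros)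
  from vector_diff_chain_at[OF this] show "(f has_vector_derivative f') (at (t + c)) \<Longrightarrow> ?thesis"
    by (simp add: o_def)
qed

lemma has_vector_derivative_shift_minus:
  "(f has_vector_derivative f') (at (t - c)) \<Longrightarrow> ((\<lambda>t. f (t - c)) has_vector_derivative f') (at t)"
  using has_vector_derivative_shift[of f f' t "- c"] by simp

lemma
  assumes "smooth_fun g"
  shows nderiv_shift: "nderiv k (\<lambda>t. g (t + c)) = (\<lambda>t. nderiv k g (t + c))"
    and smooth_fun_shift: "smooth_fun (\<lambda>t. g (t + c))"
  by (rule nderiv_by_derivatives smooth_funI_derivatives[where F = "\<lambda>k t. nderiv k g (t + c)"];
      simp add: has_vector_derivative_shift smooth_fun_has_vector_derivative assms)+

lemma
  assumes "smooth_fun g"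
  shows nderiv_shift_minus: "nderiv k (\<lambda>t. g (t - c)) = (\<lambda>t. nderiv k g (t - c))"
    and smooth_fun_shift_minus: "smooth_fun (\<lambda>t. g (t - c))"
  using nderiv_shift[OF assms, of k "- c"] smooth_fun_shift[OF assms, of "- c"] by simp_all

section \<open>Commuting nilpotent matrices\<close>

lemma nilpotent_mat_mult_commuting:
  assumes "M ** N = N ** M" "nilpotent_mat N"
  shows "nilpotent_mat ((M::complex^'n::finite^'n) ** N)"
proof -
  obtain k where "mpow N k = 0" using assms(2) unfolding nilpotent_mat_def by blast
  then show ?thesis unfolding nilpotent_mat_def using mpow_mult_commuting[OF assms(1), of k] by auto
qed

lemma mpow_eq_0_mono: "mpow (M::complex^'n::finite^'n) k = 0 \<Longrightarrow> k \<le> m \<Longrightarrow> mpow M m = 0"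
  using mpow_add[of M k "m - k"] by simp

lemma scaleR_eq_complex_scalar_mult: "c *\<^sub>R (x::complex^'n) = complex_of_real c *s x"
  by (simp add: vec_eq_iff of_real_def)

lemma subspace_of_vec_subspace: "vec.subspace (V::(complex^'n::finite) set) \<Longrightarrow> subspace V"
  unfolding subspace_def scaleR_eq_complex_scalar_mult
  using vec.subspace_0 vec.subspace_add vec.subspace_scale by blast

text \<open>A complex span, so that its dimension is bounded by \<open>CARD('n)\<close>.\<close>

definition joint_range :: "complex^'n^'n \<Rightarrow> complex^'n^'n \<Rightarrow> nat \<Rightarrow> (complex^'n) set" where
  "joint_range P Q k = vec.span {mpow P a *v (mpow Q b *v v) | a b v. a + b = k}"

lemma joint_range_0: "joint_range P Q 0 = UNIV"
proof -
  have "v \<in> joint_range P Q 0" for v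
    unfolding joint_range_def by (rule vec.span_base) (auto intro!: exI[of _ v])
  then show ?thesis by blast
qed

lemma joint_range_subspace: "vec.subspace (joint_range P Q k)"
  unfolding joint_range_def by (rule vec.subspace_span)

context
  fixes P Q :: "complex^'n::finite^'n"
  assumes PQ: "P ** Q = Q ** P"
begin

lemma monomial_step:
  "P *v (mpow P a *v (mpow Q b *v v)) = mpow P (Suc a) *v (mpow Q b *v v)"
  "Q *v (mpow P a *v (mpow Q b *v v)) = mpow P a *v (mpow Q (Suc b) *v v)"
  "mpow P a *v (mpow Q b *v (P *v v)) = mpow P (Suc a) *v (mpow Q b *v v)"
  "mpow P a *v (mpow Q b *v (Q *v v)) = mpow P a *v (mpow Q (Suc b) *v v)"
proof -
  have PaQ: "Q ** mpow P a = mpow P a ** Q" and QbP: "mpow Q b ** P = P ** mpow Q b"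
    using mpow_commute[OF PQ, of a] mpow_commute[OF PQ[symmetric], of b] by simp_all
  have PaP: "mpow P a ** P = P ** mpow P a" and QbQ: "mpow Q b ** Q = Q ** mpow Q b"
    by (simp_all add: mpow_commute)
  show "P *v (mpow P a *v (mpow Q b *v v)) = mpow P (Suc a) *v (mpow Q b *v v)"
    by (simp add: matrix_vector_mul_assoc mpow_Suc matrix_mul_assoc)
  show "Q *v (mpow P a *v (mpow Q b *v v)) = mpow P a *v (mpow Q (Suc b) *v v)"
    by (simp only: matrix_vector_mul_assoc mpow_Suc PaQ matrix_mul_assoc)
  show "mpow P a *v (mpow Q b *v (P *v v)) = mpow P (Suc a) *v (mpow Q b *v v)"
    by (simp only: matrix_vector_mul_assoc mpow_Suc QbP PaP[symmetric] matrix_mul_assoc[symmetric])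
  show "mpow P a *v (mpow Q b *v (Q *v v)) = mpow P a *v (mpow Q (Suc b) *v v)"
    by (simp only: matrix_vector_mul_assoc mpow_Suc QbQ)
qed

lemma joint_range_Suc:
  "joint_range P Q (Suc k) = vec.span ((*v) P ` joint_range P Q k \<union> (*v) Q ` joint_range P Q k)"
proof (rule antisym)
  let ?G = "\<lambda>k. {mpow P a *v (mpow Q b *v v) | a b v. a + b = k}"
  have "?G (Suc k) \<subseteq> (*v) P ` ?G k \<union> (*v) Q ` ?G k"
  proof
    fix w assume "w \<in> ?G (Suc k)"
    then obtain a b v where w: "w = mpow P a *v (mpow Q b *v v)" "a + b = Suc k" by blast
    show "w \<in> (*v) P ` ?G k \<union> (*v) Q ` ?G k"
    proof (cases a)
      case 0
      then have "w = Q *v (mpow P 0 *v (mpow Q (b - 1) *v v))" "0 + (b - 1) = k"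
        using w monomial_step(2)[of 0 "b - 1" v] by (simp_all add: Suc_diff_le)
      then show ?thesis by blast
    next
      case (Suc a')
      then have "w = P *v (mpow P a' *v (mpow Q b *v v))" "a' + b = k"
        using w monomial_step(1)[of a' b v] by simp_all
      then show ?thesis by blast
    qed
  qed
  also have "\<dots> \<subseteq> (*v) P ` joint_range P Q k \<union> (*v) Q ` joint_range P Q k"
    unfolding joint_range_def by (intro Un_mono image_mono vec.span_superset)
  finally show "joint_range P Q (Suc k)
      \<subseteq> vec.span ((*v) P ` joint_range P Q k \<union> (*v) Q ` joint_range P Q k)"
    unfolding joint_range_def[of _ _ "Suc k"] by (rule vec.span_mono)
  have "(*v) P ` ?G k \<union> (*v) Q ` ?G k \<subseteq> ?G (Suc k)"
    using monomial_step(1,2) by fastforce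
  then have "vec.span ((*v) P ` ?G k \<union> (*v) Q ` ?G k) \<subseteq> joint_range P Q (Suc k)"
    unfolding joint_range_def by (rule vec.span_mono)
  then show "vec.span ((*v) P ` joint_range P Q k \<union> (*v) Q ` joint_range P Q k)
      \<subseteq> joint_range P Q (Suc k)"
    by (simp add: joint_range_def vec.span_image[symmetric] image_Un[symmetric] vec.span_Un
        vec.span_span)
qed


lemma matrix_vector_mult_in_joint_range:
  assumes "v \<in> joint_range P Q k"
  shows "P *v v \<in> joint_range P Q (Suc k)" "Q *v v \<in> joint_range P Q (Suc k)"
  using assms unfolding joint_range_Suc by (auto intro: vec.span_base)

lemma joint_range_Suc_subset: "joint_range P Q (Suc k) \<subseteq> joint_range P Q k"
proof (induction k)
  case (Suc k)
  then show ?case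
    unfolding joint_range_Suc[of "Suc k"] joint_range_Suc[of k] by (intro vec.span_mono) blast
qed (simp add: joint_range_0)

lemma joint_range_antimono: "k \<le> m \<Longrightarrow> joint_range P Q m \<subseteq> joint_range P Q k"
  by (induction m rule: dec_induct) (use joint_range_Suc_subset in blast)+

lemma joint_range_eq_0:
  assumes "mpow P p = 0" "mpow Q q = 0" "p + q \<le> k"
  shows "joint_range P Q k = {0}"
proof -
  have "mpow P a *v (mpow Q b *v v) = 0" if "a + b = k" for a b v
    using that assms mpow_eq_0_mono[of P p a] mpow_eq_0_mono[of Q q b] by (cases "p \<le> a") auto
  then have "{mpow P a *v (mpow Q b *v v) | a b v. a + b = k} \<subseteq> {0}" by blast
  then have "joint_range P Q k \<subseteq> vec.span {0}"
    unfolding joint_range_def by (rule vec.span_mono)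
  then show ?thesis
    using vec.subspace_0[OF joint_range_subspace] by auto
qed

text \<open>The chain of joint ranges decreases strictly until it reaches \<open>{0}\<close>, because once it
  is stationary it stays so and the ranges vanish eventually.\<close>

lemma joint_range_dim:
  assumes "mpow P p = 0" "mpow Q q = 0"
  shows "joint_range P Q m = {0} \<or> vec.dim (joint_range P Q m) + m \<le> CARD('n)"
proof (induction m)
  case 0
  show ?case by (simp add: joint_range_0 vec.dim_UNIV card_cart_basis)
next
  case (Suc m)
  show ?case
  proof (cases "joint_range P Q (Suc m) = joint_range P Q m")
    case True
    have "joint_range P Q (m + j) = joint_range P Q m" for j
    proof (induction j)
      case (Suc j)
      have "joint_range P Q (m + Suc j)
          = vec.span ((*v) P ` joint_range P Q (m + j) \<union> (*v) Q ` joint_range P Q (m + j))"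
        by (simp add: joint_range_Suc)
      also have "\<dots> = joint_range P Q m"
        using True by (simp add: Suc.IH joint_range_Suc)
      finally show ?case .
    qed simp
    from this[of "p + q"] have "joint_range P Q m = {0}"
      using joint_range_eq_0[OF assms, of "m + (p + q)"] by simp
    then show ?thesis using True by simp
  next
    case False
    then have "joint_range P Q (Suc m) \<subset> joint_range P Q m"
      using joint_range_Suc_subset by blast
    then have "vec.span (joint_range P Q (Suc m)) \<subset> vec.span (joint_range P Q m)"
      by (simp add: vec.span_eq_iff[THEN iffD2, OF joint_range_subspace])
    then have "vec.dim (joint_range P Q (Suc m)) < vec.dim (joint_range P Q m)"
      by (rule vec.dim_psubset)
    with Suc.IH show ?thesis
      using joint_range_Suc_subset[of m] by auto
  qed
qed

lemma joint_range_CARD: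
  assumes "nilpotent_mat P" "nilpotent_mat Q"
  shows "joint_range P Q CARD('n) = {0}"
proof -
  obtain p q where "mpow P p = 0" "mpow Q q = 0"
    using assms unfolding nilpotent_mat_def by blast
  from joint_range_dim[OF this, of "CARD('n)"]
  have "joint_range P Q CARD('n) \<subseteq> {0}"
    using vec.dim_eq_0 by auto
  then show ?thesis
    using vec.subspace_0[OF joint_range_subspace] by auto
qed

lemma commuting_nilpotent_monomial_eq_0:
  assumes "nilpotent_mat P" "nilpotent_mat Q" "CARD('n) \<le> a + b"
  shows "mpow P a ** mpow Q b = 0"
proof -
  have "mpow P a *v (mpow Q b *v v) \<in> joint_range P Q CARD('n)" for v
    using joint_range_antimono[OF assms(3)] unfolding joint_range_def
      by (blast intro: vec.span_base)
  then show ?thesis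
    using joint_range_CARD[OF assms(1,2)] by (simp add: matrix_eq matrix_vector_mul_assoc)
qed

end

section \<open>The algebraic block\<close>

lemma ddae_solutionD:
  assumes "ddae_solution E A B \<tau> f \<phi> x"
  shows "continuous_on {-\<tau>..} x" and "\<And>t. t \<in> {-\<tau>..0} \<Longrightarrow> x t = \<phi> t"
    and "\<And>t. t \<ge> 0 \<Longrightarrow> (\<forall>j::nat. t \<noteq> real j * \<tau>) \<Longrightarrow>
      ((\<lambda>s. E *v x s) has_vector_derivative A *v x t + B *v x (t - \<tau>) + f t) (at t)"
  using assms unfolding ddae_solution_def by auto

lemma grid_interval_exists:
  assumes "\<tau> > 0" "t \<ge> 0"
  obtains j :: nat where "real j * \<tau> \<le> t" "t < (real j + 1) * \<tau>"
proof -
  define j where "j = nat \<lfloor>t / \<tau>\<rfloor>"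
  have "real j = of_int \<lfloor>t / \<tau>\<rfloor>" using assms by (simp add: j_def)
  then have "real j \<le> t / \<tau>" "t / \<tau> < real j + 1"
    by (metis of_int_floor_le, metis real_of_int_floor_add_one_gt)
  then have "real j * \<tau> \<le> t" "t < (real j + 1) * \<tau>"
    using assms by (simp_all add: pos_le_divide_eq pos_divide_less_eq)
  then show ?thesis by (rule that)
qed

lemma not_grid_point_between:
  assumes "\<tau> > 0" "real j * \<tau> < t" "t < (real j + 1) * \<tau>"
  shows "t \<noteq> real m * \<tau>"
proof
  assume "t = real m * \<tau>"
  with assms have "real j < real m" "real m < real j + 1" by auto
  then have "j < m" "m < Suc j" by linarith+
  then show False by simp
qed

lemma continuous_eq_0_off_grid:
  fixes u :: "real \<Rightarrow> 'a::real_normed_vector"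
  assumes tau: "\<tau> > 0" and cont: "continuous_on {-\<tau>..} u"
    and z: "\<And>t. t \<ge> 0 \<Longrightarrow> (\<forall>j::nat. t \<noteq> real j * \<tau>) \<Longrightarrow> u (t - \<tau>) = 0"
    and s: "s \<ge> -\<tau>"
  shows "u s = 0"
proof -
  obtain j :: nat where j: "real j * \<tau> \<le> s + \<tau>" "s + \<tau> < (real j + 1) * \<tau>"
    using grid_interval_exists[OF tau, of "s + \<tau>"] s by auto
  have "\<forall>\<^sub>F r in at_right s. u r = 0"
  proof (rule eventually_at_rightI)
    fix r assume "r \<in> {s<..<(real j + 1) * \<tau> - \<tau>}"
    then have "\<forall>m::nat. r + \<tau> \<noteq> real m * \<tau>" "r + \<tau> \<ge> 0"
      using j s not_grid_point_between[OF tau, of j "r + \<tau>"] by auto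
    from z[OF this(2,1)] show "u r = 0" by simp
  qed (use j in simp)
  moreover have "(u \<longlongrightarrow> u s) (at_right s)"
    using cont s unfolding continuous_on_def
    by (metis atLeast_iff at_within_Ici_at_right order.refl tendsto_within_subset
        atLeast_subset_iff)
  ultimately show ?thesis
    using tendsto_unique[OF trivial_limit_at_right_real] tendsto_eventually by metis
qed

lemma has_vector_derivative_in_subspace:
  fixes f :: "real \<Rightarrow> 'a::euclidean_space"
  assumes f': "(f has_vector_derivative f') (at x)" and V: "subspace V" and fV: "\<And>y. f y \<in> V"
  shows "f' \<in> V"
proof -
  have "(\<lambda>h. norm (f (x + h) - f x - h *\<^sub>R f') / norm h) \<midarrow>0\<rightarrow> 0"
    using f' unfolding has_vector_derivative_def has_derivative_at by simp
  then have "(\<lambda>h. (f (x + h) - f x) /\<^sub>R h - f') \<midarrow>0\<rightarrow> 0"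
  proof (rule Lim_transform_bound[rotated])
    have "norm ((f (x + h) - f x) /\<^sub>R h - f') = norm (f (x + h) - f x - h *\<^sub>R f') / \<bar>h\<bar>"
      if "h \<noteq> 0" for h
    proof -
      have "(f (x + h) - f x) /\<^sub>R h - f' = inverse h *\<^sub>R (f (x + h) - f x - h *\<^sub>R f')"
        using that by (simp add: scaleR_diff_right)
      then show ?thesis by (simp add: divide_inverse mult.commute)
    qed
    then show "\<forall>\<^sub>F h in at 0. norm ((f (x + h) - f x) /\<^sub>R h - f')
        \<le> norm (norm (f (x + h) - f x - h *\<^sub>R f') / norm h)"
      by (auto simp: eventually_at_filter)
  qed
  then have lim: "((\<lambda>h. (f (x + h) - f x) /\<^sub>R h) \<longlongrightarrow> f') (at 0)"
    by (simp add: LIM_zero_iff)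
  have "\<forall>\<^sub>F h in at 0. (f (x + h) - f x) /\<^sub>R h \<in> V"
    using fV V by (auto intro!: always_eventually subspace_scale subspace_diff)
  from Lim_in_closed_set[OF closed_subspace[OF V] this _ lim] show ?thesis by simp
qed

lemma delay_equation_annihilator_step:
  fixes P Q W :: "complex^'n::finite^'n" and e :: "real \<Rightarrow> complex^'n"
  assumes tau: "\<tau> > 0" and cont: "continuous_on {-\<tau>..} e"
    and de: "\<And>t. t \<ge> 0 \<Longrightarrow> (\<forall>j::nat. t \<noteq> real j * \<tau>) \<Longrightarrow>
      ((\<lambda>s. P *v e s) has_vector_derivative Q *v e t + e (t - \<tau>)) (at t)"
    and WP: "\<And>s. s \<ge> -\<tau> \<Longrightarrow> W *v (P *v e s) = 0" and WQ: "\<And>s. s \<ge> -\<tau> \<Longrightarrow> W *v (Q *v e s) = 0"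
    and s: "s \<ge> -\<tau>"
  shows "W *v e s = 0"
proof (rule continuous_eq_0_off_grid[OF tau _ _ s])
  show "continuous_on {-\<tau>..} (\<lambda>s. W *v e s)"
    by (intro bounded_linear.continuous_on[OF matrix_vector_mul_bounded_linear] cont)
  fix t assume t: "t \<ge> 0" "\<forall>j::nat. t \<noteq> real j * \<tau>"
  have d: "((\<lambda>s. W *v (P *v e s)) has_vector_derivative W *v (Q *v e t + e (t - \<tau>))) (at t)"
    by (intro bounded_linear.has_vector_derivative[OF matrix_vector_mul_bounded_linear] de t)
  have "((\<lambda>s. 0) has_vector_derivative W *v (Q *v e t + e (t - \<tau>))) (at t)"
    by (rule has_vector_derivative_transform_within_open[OF d, of "{-\<tau><..}"]) (use t tau WP in auto)
  then have "W *v (Q *v e t + e (t - \<tau>)) = 0"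
    using vector_derivative_unique_at has_vector_derivative_const by blast
  with WQ[of t] t tau show "W *v e (t - \<tau>) = 0" by (simp add: matrix_vector_right_distrib)
qed

text \<open>The homogeneous equation \<open>P e' = Q e + e(t - \<tau>)\<close> with commuting nilpotent \<open>P\<close>, \<open>Q\<close> has
  only the trivial solution: by downward induction on \<open>a + b\<close>, every \<open>P\<^sup>a Q\<^sup>b e\<close> vanishes.\<close>

lemma commuting_nilpotent_delay_eq_0:
  fixes P Q :: "complex^'n::finite^'n" and e :: "real \<Rightarrow> complex^'n"
  assumes tau: "\<tau> > 0" and PQ: "P ** Q = Q ** P" and nil: "nilpotent_mat P" "nilpotent_mat Q"
    and cont: "continuous_on {-\<tau>..} e"
    and de: "\<And>t. t \<ge> 0 \<Longrightarrow> (\<forall>j::nat. t \<noteq> real j * \<tau>) \<Longrightarrow>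
      ((\<lambda>s. P *v e s) has_vector_derivative Q *v e t + e (t - \<tau>)) (at t)"
    and s: "s \<ge> -\<tau>"
  shows "e s = 0"
proof -
  have "(mpow P a ** mpow Q b) *v e s = 0" if "a + b = CARD('n) - k" "k \<le> CARD('n)" "s \<ge> -\<tau>"
    for k a b s
    using that
  proof (induction k arbitrary: a b s)
    case 0
    then show ?case using commuting_nilpotent_monomial_eq_0[OF PQ nil] by simp
  next
    case (Suc k)
    show ?case
    proof (rule delay_equation_annihilator_step[OF tau cont de _ _ Suc.prems(3)])
      show "(mpow P a ** mpow Q b) *v (P *v e s) = 0" "(mpow P a ** mpow Q b) *v (Q *v e s) = 0"
        if "s \<ge> -\<tau>" for s
        using Suc.IH[of "Suc a" b s] Suc.IH[of a "Suc b" s] Suc.prems that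
          monomial_step(3,4)[OF PQ, of a b "e s"]
        by (simp_all add: matrix_vector_mul_assoc[symmetric])
    qed
  qed
  from this[of 0 0 "CARD('n)"] s show ?thesis by simp
qed

definition diff_op :: "complex^'n^'n \<Rightarrow> complex^'n^'n \<Rightarrow> (real \<Rightarrow> complex^'n) \<Rightarrow> real \<Rightarrow> complex^'n"
  where "diff_op P Q g s = P *v vector_derivative g (at s) - Q *v g s"

lemma diff_op_nderiv: "diff_op P Q g s = P *v nderiv 1 g s - Q *v g s"
  by (simp add: diff_op_def nderiv.simps(2))

lemma diff_op_power_Suc:
  "(diff_op P Q ^^ Suc k) f s = P *v nderiv 1 ((diff_op P Q ^^ k) f) s - Q *v (diff_op P Q ^^ k) f s"
  by (simp add: diff_op_nderiv)

lemma smooth_fun_diff_op_power: "smooth_fun f \<Longrightarrow> smooth_fun ((diff_op P Q ^^ k) f)"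
proof (induction k)
  case (Suc k)
  then show ?case
    unfolding diff_op_power_Suc[abs_def]
    by (intro smooth_fun_diff smooth_fun_matrix_vector_mult smooth_fun_nderiv)
qed simp

text \<open>The operator \<open>g \<mapsto> P g' - Q g\<close> is nilpotent on smooth functions, because the values of
  its \<open>k\<close>-th power lie in the joint range of order \<open>k\<close>.\<close>

lemma diff_op_power_in_joint_range:
  assumes PQ: "P ** Q = Q ** P" and f: "smooth_fun f"
  shows "(diff_op P Q ^^ k) f s \<in> joint_range P Q k"
proof (induction k arbitrary: s)
  case (Suc k)
  have "nderiv 1 ((diff_op P Q ^^ k) f) s \<in> joint_range P Q k"
    by (rule has_vector_derivative_in_subspace[OF smooth_fun_has_vector_derivative_0
          [OF smooth_fun_diff_op_power[OF f]] subspace_of_vec_subspace[OF joint_range_subspace] Suc.IH])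
  then show ?case
    unfolding diff_op_power_Suc
    by (intro vec.subspace_diff[OF joint_range_subspace] matrix_vector_mult_in_joint_range[OF PQ]
        Suc.IH)
qed (simp add: joint_range_0)

lemma diff_op_power_CARD:
  fixes P Q :: "complex^'n::finite^'n"
  assumes "P ** Q = Q ** P" "nilpotent_mat P" "nilpotent_mat Q" "smooth_fun f"
  shows "(diff_op P Q ^^ CARD('n)) f s = 0"
  using diff_op_power_in_joint_range[OF assms(1,4), of "CARD('n)" s] joint_range_CARD[OF assms(1-3)]
  by simp

lemma diff_op_shifted_sum:
  fixes P Q :: "complex^'n::finite^'n" and \<tau> :: real
  assumes PQ: "P ** Q = Q ** P" and nil: "nilpotent_mat P" "nilpotent_mat Q" and f: "smooth_fun f"
    and H_def: "H = (\<lambda>s. \<Sum>i<CARD('n). (diff_op P Q ^^ i) f (s + (real i + 1) * \<tau>))"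
  shows "smooth_fun H" and "H s = f (s + \<tau>) + diff_op P Q H (s + \<tau>)"
proof -
  let ?n = "CARD('n)" and ?D = "diff_op P Q"
  show smooth_H: "smooth_fun H"
    unfolding H_def by (intro smooth_fun_sum smooth_fun_shift smooth_fun_diff_op_power f)
  have "nderiv 1 H s = (\<Sum>i<?n. nderiv 1 ((?D ^^ i) f) (s + (real i + 1) * \<tau>))" for s
    unfolding H_def
      by (simp add: nderiv_sum smooth_fun_shift smooth_fun_diff_op_power f nderiv_shift)
  then have DH: "?D H s = (\<Sum>i<?n. (?D ^^ Suc i) f (s + (real i + 1) * \<tau>))" for s
    unfolding diff_op_nderiv[of P Q H] diff_op_power_Suc by (simp add: H_def vec.sum sum_subtractf)
  obtain m where m: "?n = Suc m" using not0_implies_Suc[of ?n] by auto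
  have "H s = f (s + \<tau>) + (\<Sum>i<m. (?D ^^ Suc i) f (s + \<tau> + (real i + 1) * \<tau>))"
    unfolding H_def m sum.lessThan_Suc_shift by (simp add: algebra_simps)
  also have "(\<Sum>i<m. (?D ^^ Suc i) f (s + \<tau> + (real i + 1) * \<tau>)) = ?D H (s + \<tau>)"
    unfolding DH m using diff_op_power_CARD[OF PQ nil f, unfolded m] by simp
  finally show "H s = f (s + \<tau>) + ?D H (s + \<tau>)" .
qed

text \<open>With \<open>H\<close> as above, \<open>x + H\<close> solves the homogeneous equation.\<close>

lemma ddae_solution_commuting_nilpotent:
  fixes P Q :: "complex^'n::finite^'n"
  assumes tau: "\<tau> > 0" and PQ: "P ** Q = Q ** P" and nil: "nilpotent_mat P" "nilpotent_mat Q"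
    and f: "smooth_fun f" and x: "ddae_solution P Q (mat 1) \<tau> f \<phi> x" and t: "t \<ge> -\<tau>"
  shows "x t = - (\<Sum>i<CARD('n). (diff_op P Q ^^ i) f (t + (real i + 1) * \<tau>))"
proof -
  define H where "H = (\<lambda>s. \<Sum>i<CARD('n). (diff_op P Q ^^ i) f (s + (real i + 1) * \<tau>))"
  note H = diff_op_shifted_sum[OF PQ nil f H_def]
  define e where "e = (\<lambda>s. x s + H s)"
  have "e t = 0"
  proof (rule commuting_nilpotent_delay_eq_0[OF tau PQ nil _ _ t])
    show "continuous_on {-\<tau>..} e"
      unfolding e_def
        by (intro continuous_on_add ddae_solutionD(1)[OF x] smooth_fun_continuous_on H(1))
    fix s assume s: "s \<ge> 0" "\<forall>j::nat. s \<noteq> real j * \<tau>"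
    have "((\<lambda>s. P *v e s) has_vector_derivative
        (Q *v x s + x (s - \<tau>) + f s) + P *v nderiv 1 H s) (at s)"
      unfolding e_def matrix_vector_right_distrib
      using ddae_solutionD(3)[OF x s] smooth_fun_has_vector_derivative_0[OF H(1)]
      by (auto intro!: has_vector_derivative_add bounded_linear.has_vector_derivative
          [OF matrix_vector_mul_bounded_linear])
    moreover have "(Q *v x s + x (s - \<tau>) + f s) + P *v nderiv 1 H s = Q *v e s + e (s - \<tau>)"
      using H(2)[of "s - \<tau>"] by (simp add: e_def diff_op_nderiv matrix_vector_right_distrib)
    ultimately show "((\<lambda>s. P *v e s) has_vector_derivative Q *v e s + e (s - \<tau>)) (at s)"
      by simp
  qed
  then show ?thesis by (simp add: e_def H_def eq_neg_iff_add_eq_0)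
qed

section \<open>The nilpotent block\<close>

lemma mpow_nilpotency_index: "nilpotent_mat N \<Longrightarrow> mpow N (nilpotency_index N) = 0"
  unfolding nilpotency_index_def nilpotent_mat_def by (rule LeastI_ex)

lemma nilpotent_derivative_eq_0:
  fixes N :: "complex^'n::finite^'n" and e :: "real \<Rightarrow> complex^'n"
  assumes N: "mpow N \<zeta> = 0"
    and d: "\<And>t. t \<in> {a<..<b} \<Longrightarrow> ((\<lambda>s. N *v e s) has_vector_derivative e t) (at t)"
    and t: "t \<in> {a<..<b}"
  shows "e t = 0"
proof -
  have "\<forall>t\<in>{a<..<b}. mpow N (\<zeta> - k) *v e t = 0" if "k \<le> \<zeta>" for k
    using that
  proof (induction k)
    case (Suc k)
    have N_Suc: "mpow N (\<zeta> - Suc k) ** N = mpow N (\<zeta> - k)"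
      using mpow_add[of N "\<zeta> - Suc k" 1] Suc.prems by (simp add: Suc_diff_Suc mpow_Suc)
    show ?case
    proof
      fix t assume t: "t \<in> {a<..<b}"
      have d': "((\<lambda>s. mpow N (\<zeta> - Suc k) *v (N *v e s)) has_vector_derivative
          mpow N (\<zeta> - Suc k) *v e t) (at t)"
        by (rule bounded_linear.has_vector_derivative[OF matrix_vector_mul_bounded_linear d[OF t]])
      have "mpow N (\<zeta> - Suc k) *v (N *v e s) = 0" if "s \<in> {a<..<b}" for s
        using Suc that by (simp add: matrix_vector_mul_assoc N_Suc)
      then have "((\<lambda>s. 0) has_vector_derivative mpow N (\<zeta> - Suc k) *v e t) (at t)"
        by (rule has_vector_derivative_transform_within_open[OF d', of "{a<..<b}", rotated 2])
          (use t in auto)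
      then show "mpow N (\<zeta> - Suc k) *v e t = 0"
        using vector_derivative_unique_at has_vector_derivative_const by blast
    qed
  qed (simp add: N)
  from this[of \<zeta>] t show ?thesis by simp
qed

text \<open>On an interval, \<open>N y' = y + h\<close> with nilpotent \<open>N\<close> has the unique continuous solution
  \<open>y = -\<Sum>\<^sub>i N\<^sup>i h\<^sup>(\<^sup>i\<^sup>)\<close>: adding this sum to \<open>y\<close> gives a solution of \<open>N e' = e\<close>.\<close>

lemma nilpotent_ode_solution:
  fixes N :: "complex^'n::finite^'n" and y h :: "real \<Rightarrow> complex^'n"
  assumes N: "mpow N \<zeta> = 0" and ab: "a < b" and h: "smooth_fun h"
    and y: "continuous_on {a..b} y"
    and de: "\<And>t. t \<in> {a<..<b} \<Longrightarrow> ((\<lambda>s. N *v y s) has_vector_derivative y t + h t) (at t)"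
    and t: "t \<in> {a..b}"
  shows "y t = - (\<Sum>i<\<zeta>. mpow N i *v nderiv i h t)"
proof -
  define K where "K = (\<lambda>t. \<Sum>i<\<zeta>. mpow N i *v nderiv i h t)"
  have smooth_K: "smooth_fun K"
    unfolding K_def by (intro smooth_fun_sum smooth_fun_matrix_vector_mult smooth_fun_nderiv h)
  have "nderiv 1 K t = (\<Sum>i<\<zeta>. mpow N i *v nderiv (Suc i) h t)" for t
    unfolding K_def
    by (simp add: nderiv_sum smooth_fun_matrix_vector_mult smooth_fun_nderiv h
        nderiv_matrix_vector_mult nderiv_nderiv)
  then have K_rec: "h t + N *v nderiv 1 K t = K t" for t
    using sum.lessThan_Suc_shift[of "\<lambda>i. mpow N i *v nderiv i h t" \<zeta>]
    by (simp add: K_def N vec.sum matrix_vector_mul_assoc mpow_Suc)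
  define e where "e = (\<lambda>s. y s + K s)"
  have "e t = 0" if t: "t \<in> {a<..<b}" for t
  proof (rule nilpotent_derivative_eq_0[OF N _ t])
    fix t assume t: "t \<in> {a<..<b}"
    have "((\<lambda>s. N *v e s) has_vector_derivative (y t + h t) + N *v nderiv 1 K t) (at t)"
      unfolding e_def matrix_vector_right_distrib
      using de[OF t] smooth_fun_has_vector_derivative_0[OF smooth_K]
      by (auto intro!: has_vector_derivative_add bounded_linear.has_vector_derivative
          [OF matrix_vector_mul_bounded_linear])
    then show "((\<lambda>s. N *v e s) has_vector_derivative e t) (at t)"
      by (simp add: e_def K_rec[symmetric] add.assoc)
  qed
  moreover have "continuous_on {a..b} e"
    unfolding e_def by (intro continuous_on_add y smooth_fun_continuous_on[OF smooth_K])
  ultimately have "e t = 0"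
    using continuous_constant_on_closure[of "{a<..<b}" e 0 t] t ab by auto
  then show ?thesis by (simp add: e_def K_def eq_neg_iff_add_eq_0)
qed

lemma rderiv_eq_nderiv:
  fixes y G :: "real \<Rightarrow> 'v::real_normed_vector"
  assumes G: "smooth_fun G" and eq: "\<And>r. r \<in> {a..b} \<Longrightarrow> y r = G r"
  shows "s \<in> {a..<b} \<Longrightarrow> rderiv i y s = nderiv i G s"
proof (induction i arbitrary: s)
  case (Suc i)
  have "rderiv (Suc i) y s = vector_derivative (rderiv i y) (at s within {s..})"
    by (simp add: rderiv.simps(2))
  also have "\<dots> = vector_derivative (nderiv i G) (at s within {s..})"
  proof (rule vector_derivative_cong_eq)
    have "\<forall>\<^sub>F r in nhds s. r \<in> {..<b}" using Suc.prems by (intro eventually_nhds_in_open) auto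
    then show "\<forall>\<^sub>F r in nhds s. r \<in> {s..} \<longrightarrow> rderiv i y r = nderiv i G r"
      by eventually_elim (use Suc.IH Suc.prems in auto)
  qed auto
  also have "\<dots> = nderiv (Suc i) G s"
    by (rule vector_derivative_within)
      (simp_all add: at_within_Ici_at_right has_vector_derivative_at_within
        smooth_fun_has_vector_derivative[OF G])
  finally show ?case .
qed (use eq in auto)

text \<open>The method of steps: \<open>nilpotent_steps N B \<tau> f \<phi> j\<close> is the solution on
  \<open>[(j - 1)\<tau>, j\<tau>]\<close>; on each interval the delayed term is a known smooth function, namely the
  solution on the previous interval.\<close>

fun nilpotent_steps ::
  "complex^'n^'n \<Rightarrow> complex^'n^'n \<Rightarrow> real \<Rightarrow> (real \<Rightarrow> complex^'n) \<Rightarrow> (real \<Rightarrow> complex^'n) \<Rightarrow>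
    nat \<Rightarrow> real \<Rightarrow> complex^'n"
  where
    "nilpotent_steps N B \<tau> f \<phi> 0 = \<phi>"
  | "nilpotent_steps N B \<tau> f \<phi> (Suc j) = (\<lambda>t. - (\<Sum>i<nilpotency_index N. mpow N i *v
      (B *v nderiv i (nilpotent_steps N B \<tau> f \<phi> j) (t - \<tau>) + nderiv i f t)))"

lemma smooth_fun_nilpotent_steps:
  "smooth_fun f \<Longrightarrow> smooth_fun \<phi> \<Longrightarrow> smooth_fun (nilpotent_steps N B \<tau> f \<phi> j)"
  by (induction j) (simp_all add: smooth_fun_uminus smooth_fun_sum smooth_fun_matrix_vector_mult
      smooth_fun_add smooth_fun_shift_minus smooth_fun_nderiv)

lemma ddae_solution_nilpotent_steps:
  fixes N B :: "complex^'n::finite^'n"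
  assumes tau: "\<tau> > 0" and N: "nilpotent_mat N" and f: "smooth_fun f" and \<phi>: "smooth_fun \<phi>"
    and x: "ddae_solution N (mat 1) B \<tau> f \<phi> x" and s: "s \<in> {(real j - 1) * \<tau> .. real j * \<tau>}"
  shows "x s = nilpotent_steps N B \<tau> f \<phi> j s"
  using s
proof (induction j arbitrary: s)
  case 0
  then show ?case using ddae_solutionD(2)[OF x] by simp
next
  case (Suc j)
  let ?G = "nilpotent_steps N B \<tau> f \<phi> j"
  define h where "h = (\<lambda>t. B *v ?G (t - \<tau>) + f t)"
  have smooth_h: "smooth_fun h"
    unfolding h_def by (intro smooth_fun_add smooth_fun_matrix_vector_mult smooth_fun_shift_minus
        smooth_fun_nilpotent_steps f \<phi>)
  have "x s = - (\<Sum>i<nilpotency_index N. mpow N i *v nderiv i h s)"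
  proof (rule nilpotent_ode_solution[OF mpow_nilpotency_index[OF N] _ smooth_h])
    show "real j * \<tau> < (real j + 1) * \<tau>" using tau by simp
    have "-\<tau> \<le> real j * \<tau>" by (rule order.trans[of _ 0]) (use tau in auto)
    then show "continuous_on {real j * \<tau>..(real j + 1) * \<tau>} x"
      by (intro continuous_on_subset[OF ddae_solutionD(1)[OF x]]) auto
    fix t assume t: "t \<in> {real j * \<tau><..<(real j + 1) * \<tau>}"
    have "0 \<le> real j * \<tau>" using tau by simp
    with t have t0: "t \<ge> 0" by (simp only: greaterThanLessThan_iff) linarith
    have "\<forall>m::nat. t \<noteq> real m * \<tau>" and delayed: "x (t - \<tau>) = ?G (t - \<tau>)"
      using t not_grid_point_between[OF tau] Suc.IH[of "t - \<tau>"] by (auto simp: algebra_simps)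
    from ddae_solutionD(3)[OF x t0 this(1)] delayed
    show "((\<lambda>s. N *v x s) has_vector_derivative x t + h t) (at t)"
      by (simp add: h_def add.assoc)
  qed (use Suc.prems in \<open>auto simp: algebra_simps\<close>)
  also have "\<dots> = nilpotent_steps N B \<tau> f \<phi> (Suc j) s"
    unfolding h_def
    by (simp add: nderiv_add smooth_fun_matrix_vector_mult smooth_fun_shift_minus
        smooth_fun_nilpotent_steps f \<phi> nderiv_matrix_vector_mult nderiv_shift_minus)
  finally show ?case .
qed

lemma ddae_solution_nilpotent:
  fixes N B :: "complex^'n::finite^'n"
  assumes tau: "\<tau> > 0" and N: "nilpotent_mat N" and f: "smooth_fun f" and \<phi>: "smooth_fun \<phi>"
    and x: "ddae_solution N (mat 1) B \<tau> f \<phi> x" and t: "t \<ge> 0"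
  shows "x t = - (\<Sum>i<nilpotency_index N. mpow N i *v (B *v rderiv i x (t - \<tau>) + nderiv i f t))"
proof -
  note steps = ddae_solution_nilpotent_steps[OF tau N f \<phi> x]
  obtain j :: nat where j: "real j * \<tau> \<le> t" "t < (real j + 1) * \<tau>"
    using grid_interval_exists[OF tau t] .
  have "rderiv i x (t - \<tau>) = nderiv i (nilpotent_steps N B \<tau> f \<phi> j) (t - \<tau>)" for i
    by (rule rderiv_eq_nderiv[OF smooth_fun_nilpotent_steps[OF f \<phi>],
          where a = "(real j - 1) * \<tau>" and b = "real j * \<tau>"])
      (use j steps in \<open>auto simp: algebra_simps\<close>)
  then show ?thesis
    using steps[of t "Suc j"] j by (simp add: algebra_simps)
qed

section \<open>Truncated powers and the delay exponential\<close>

text \<open>For \<open>j = 0\<close> this is the Heaviside function, with value 1 at 0.\<close>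

definition trunc_pow :: "nat \<Rightarrow> real \<Rightarrow> real" where
  "trunc_pow j z = (if 0 \<le> z then z ^ j / fact j else 0)"

lemma trunc_pow_nonpos [simp]: "z < 0 \<or> (z = 0 \<and> j > 0) \<Longrightarrow> trunc_pow j z = 0"
  by (auto simp: trunc_pow_def)

lemma trunc_pow_pos [simp]: "z > 0 \<Longrightarrow> trunc_pow j z = z ^ j / fact j"
  by (simp add: trunc_pow_def)

lemma continuous_on_trunc_pow: "j > 0 \<Longrightarrow> continuous_on S (trunc_pow j)"
proof -
  assume "j > 0"
  then have "trunc_pow j = (\<lambda>z. max z 0 ^ j / fact j)"
    by (auto simp: trunc_pow_def max_def fun_eq_iff)
  then show ?thesis by (auto intro!: continuous_intros)
qed

lemma has_real_derivative_trunc_pow_Suc: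
  assumes "j = 0 \<longrightarrow> z \<noteq> 0"
  shows "(trunc_pow (Suc j) has_real_derivative trunc_pow j z) (at z)"
proof -
  consider "z > 0" | "z < 0" | "z = 0" "j > 0" using assms by linarith
  then show ?thesis
  proof cases
    case 1
    have "((\<lambda>z. z ^ Suc j / fact (Suc j)) has_real_derivative
        real (Suc j) * z ^ j / fact (Suc j)) (at z)"
      using DERIV_pow[of "Suc j" z] by (intro DERIV_cdivide) simp
    moreover have "real (Suc j) * z ^ j / fact (Suc j) = trunc_pow j z"
      using 1 by (simp add: fact_Suc del: of_nat_Suc)
    ultimately have "((\<lambda>z. z ^ Suc j / fact (Suc j)) has_real_derivative trunc_pow j z) (at z)"
      by simp
    then show ?thesis
      by (rule has_field_derivative_transform_within_open[of _ _ _ "{0<..}"]) (use 1 in auto)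
  next
    case 2
    have "((\<lambda>z. 0) has_real_derivative trunc_pow j z) (at z)" using 2 by simp
    then show ?thesis
      by (rule has_field_derivative_transform_within_open[of _ _ _ "{..<0}"]) (use 2 in auto)
  next
    case 3
    have "trunc_pow (Suc j) w - trunc_pow (Suc j) 0 = trunc_pow j w / real (Suc j) * (w - 0)" for w
      using 3 by (cases "0 \<le> w") (auto simp: trunc_pow_def field_simps)
    moreover have "isCont (\<lambda>w. trunc_pow j w / real (Suc j)) 0"
      using continuous_on_trunc_pow[OF 3(2), of UNIV]
      by (intro continuous_intros) (simp_all add: continuous_on_eq_continuous_at del: of_nat_Suc)
    ultimately have "(trunc_pow (Suc j) has_real_derivative trunc_pow j 0 / real (Suc j)) (at 0)"
      by (intro CARAT_DERIV[THEN iffD2] exI[of _ "\<lambda>w. trunc_pow j w / real (Suc j)"]) simp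
    then show ?thesis using 3 by simp
  qed
qed

lemma has_real_derivative_trunc_pow_0:
  "z \<noteq> 0 \<Longrightarrow> (trunc_pow 0 has_real_derivative 0) (at z)"
  by (rule has_field_derivative_transform_within_open[of "\<lambda>_. trunc_pow 0 z" _ _
        "if z > 0 then {0<..} else {..<0}"]) (auto simp: trunc_pow_def split: if_splits)

lemma has_vector_derivative_trunc_pow_shift:
  assumes "j = 0 \<longrightarrow> t \<noteq> c"
  shows "((\<lambda>t. trunc_pow (Suc j) (t - c) *\<^sub>R v) has_vector_derivative trunc_pow j (t - c) *\<^sub>R v) (at t)"
proof -
  have "((\<lambda>t. trunc_pow (Suc j) (t - c)) has_real_derivative trunc_pow j (t - c) * 1) (at t)"
    by (rule DERIV_chain2[OF has_real_derivative_trunc_pow_Suc])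
      (use assms in \<open>auto intro!: derivative_eq_intros\<close>)
  then show ?thesis
    using has_vector_derivative_scaleR[OF _ has_vector_derivative_const[of v]] by fastforce
qed

lemma has_vector_derivative_trunc_pow_0_shift:
  assumes "t \<noteq> c"
  shows "((\<lambda>t. trunc_pow 0 (t - c) *\<^sub>R v) has_vector_derivative 0) (at t)"
proof -
  have "((\<lambda>t. trunc_pow 0 (t - c)) has_real_derivative 0 * 1) (at t)"
    by (rule DERIV_chain2[OF has_real_derivative_trunc_pow_0])
      (use assms in \<open>auto intro!: derivative_eq_intros\<close>)
  then show ?thesis
    using has_vector_derivative_scaleR[OF _ has_vector_derivative_const[of v]] by fastforce
qed

definition trunc_conv :: "nat \<Rightarrow> real \<Rightarrow> real \<Rightarrow> (real \<Rightarrow> 'v::euclidean_space) \<Rightarrow> real \<Rightarrow> 'v" where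
  "trunc_conv j a b v x = integral {a..b} (\<lambda>s. trunc_pow j (x - s) *\<^sub>R v s)"

lemma clamp_real: "a \<le> b \<Longrightarrow> clamp a b x = max a (min b (x::real))"
  by (cases "x < a"; cases "x \<le> b") (auto simp: clamp_def)

lemma integral_atLeastAtMost_clamp:
  assumes "a \<le> b"
  shows "integral {a..min b x} f = integral {a..clamp a b (x::real)} f"
proof (cases "x < a")
  case True
  then have "{a..min b x} = {}" by auto
  then show ?thesis using True assms by (simp add: clamp_real max_def min_def)
qed (use assms in \<open>simp add: clamp_real max_def min_def\<close>)

lemma has_vector_derivative_integral_upper:
  fixes f :: "real \<Rightarrow> 'a::banach"
  assumes "continuous_on {a..b} f" "a < x" "x < b"
  shows "((\<lambda>u. integral {a..u} f) has_vector_derivative f x) (at x)"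
  using integral_has_vector_derivative[OF assms(1), of x] assms(2,3) by (simp add: at_within_Icc_at)

context
  fixes v :: "real \<Rightarrow> 'v::euclidean_space" and a b :: real
  assumes v: "continuous_on {a..b} v"
begin

lemma trunc_conv_integrable: "(\<lambda>s. trunc_pow j (x - s) *\<^sub>R v s) integrable_on {a..b}"
  and trunc_conv_eq: "trunc_conv j a b v x = integral {a..min b x} (\<lambda>s. ((x - s) ^ j / fact j) *\<^sub>R v s)"
proof -
  have restrict: "(\<lambda>s. trunc_pow j (x - s) *\<^sub>R v s)
      = (\<lambda>s. if s \<in> {..x} then ((x - s) ^ j / fact j) *\<^sub>R v s else 0)"
    by (auto simp: trunc_pow_def fun_eq_iff)
  have I: "{..x} \<inter> {a..b} = {a..min b x}" by auto
  have "continuous_on {a..min b x} (\<lambda>s. ((x - s) ^ j / fact j) *\<^sub>R v s)"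
    by (intro continuous_intros continuous_on_subset[OF v]) auto
  then have "(\<lambda>s. ((x - s) ^ j / fact j) *\<^sub>R v s) integrable_on {a..min b x}"
    by (rule integrable_continuous_interval)
  then show "(\<lambda>s. trunc_pow j (x - s) *\<^sub>R v s) integrable_on {a..b}"
    unfolding restrict integrable_restrict_Int I .
  show "trunc_conv j a b v x = integral {a..min b x} (\<lambda>s. ((x - s) ^ j / fact j) *\<^sub>R v s)"
    unfolding trunc_conv_def restrict integral_restrict_Int I ..
qed

text \<open>For the exponents 0 and 1 the kernel is not continuously differentiable in \<open>x\<close>; instead
  \<open>x\<close> is moved into the upper limit of integration.\<close>

lemma trunc_conv_0_eq: "a \<le> b \<Longrightarrow> trunc_conv 0 a b v = (\<lambda>x. integral {a..clamp a b x} v)"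
  by (simp add: fun_eq_iff trunc_conv_eq integral_atLeastAtMost_clamp)

lemma trunc_conv_1_eq:
  assumes "a \<le> b"
  shows "trunc_conv 1 a b v
    = (\<lambda>x. x *\<^sub>R integral {a..clamp a b x} v - integral {a..clamp a b x} (\<lambda>s. s *\<^sub>R v s))"
proof
  fix x
  have c: "{a..clamp a b x} \<subseteq> {a..b}" using assms by (auto simp: clamp_real)
  have "v integrable_on {a..clamp a b x}" "(\<lambda>s. s *\<^sub>R v s) integrable_on {a..clamp a b x}"
    by (intro integrable_continuous_interval continuous_intros continuous_on_subset[OF v c])+
  then show "trunc_conv 1 a b v x
      = x *\<^sub>R integral {a..clamp a b x} v - integral {a..clamp a b x} (\<lambda>s. s *\<^sub>R v s)"
    by (simp add: trunc_conv_eq integral_atLeastAtMost_clamp[OF assms] scaleR_diff_left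
        integral_diff integrable_cmul)
qed

lemma has_vector_derivative_trunc_conv_0:
  assumes ab: "a < b" and x: "x \<noteq> a" "x \<noteq> b"
  shows "(trunc_conv 0 a b v has_vector_derivative (if a < x \<and> x < b then v x else 0)) (at x)"
proof -
  consider "x < a" | "a < x \<and> x < b" | "b < x" using x by linarith
  then show ?thesis
  proof cases
    case 1
    have "((\<lambda>x. 0) has_vector_derivative (if a < x \<and> x < b then v x else 0)) (at x)"
      using 1 by simp
    then show ?thesis
      unfolding trunc_conv_0_eq[OF less_imp_le[OF ab]]
      by (rule has_vector_derivative_transform_within_open[of _ _ _ "{..<a}"])
        (use 1 ab in \<open>auto simp: clamp_real\<close>)
  next
    case 2
    then have "((\<lambda>u. integral {a..u} v) has_vector_derivative
        (if a < x \<and> x < b then v x else 0)) (at x)"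
      by (simp add: has_vector_derivative_integral_upper[OF v])
    then show ?thesis
      unfolding trunc_conv_0_eq[OF less_imp_le[OF ab]]
      by (rule has_vector_derivative_transform_within_open[of _ _ _ "{a<..<b}"])
        (use 2 in \<open>auto simp: clamp_real\<close>)
  next
    case 3
    have "((\<lambda>u. integral {a..b} v) has_vector_derivative (if a < x \<and> x < b then v x else 0)) (at x)"
      using 3 by simp
    then show ?thesis
      unfolding trunc_conv_0_eq[OF less_imp_le[OF ab]]
      by (rule has_vector_derivative_transform_within_open[of _ _ _ "{b<..}"])
        (use 3 ab in \<open>auto simp: clamp_real\<close>)
  qed
qed

lemma has_vector_derivative_trunc_conv_1:
  assumes ab: "a < b" and x: "x \<noteq> a" "x \<noteq> b"
  shows "(trunc_conv 1 a b v has_vector_derivative trunc_conv 0 a b v x) (at x)"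
proof -
  let ?I = "\<lambda>u. integral {a..u} v" and ?J = "\<lambda>u. integral {a..u} (\<lambda>s. s *\<^sub>R v s)"
  have v': "continuous_on {a..b} (\<lambda>s. s *\<^sub>R v s)" by (intro continuous_intros v)
  note F = trunc_conv_1_eq[OF less_imp_le[OF ab]] and F0 = trunc_conv_0_eq[OF less_imp_le[OF ab]]
  consider "x < a" | "a < x \<and> x < b" | "b < x" using x by linarith
  then show ?thesis
  proof cases
    case 1
    have "((\<lambda>x. 0) has_vector_derivative trunc_conv 0 a b v x) (at x)"
      using 1 ab by (simp add: F0 clamp_real)
    then show ?thesis
      unfolding F
      by (rule has_vector_derivative_transform_within_open[of _ _ _ "{..<a}"])
        (use 1 ab in \<open>auto simp: clamp_real\<close>)
  next
    case 2
    have "((\<lambda>u. u *\<^sub>R ?I u - ?J u) has_vector_derivative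
        (x *\<^sub>R v x + 1 *\<^sub>R ?I x) - x *\<^sub>R v x) (at x)"
      using 2
      by (intro has_vector_derivative_diff has_vector_derivative_scaleR
          has_vector_derivative_integral_upper[OF v] has_vector_derivative_integral_upper[OF v']
          has_vector_derivative_id[unfolded id_def]) auto
    then have "((\<lambda>u. u *\<^sub>R ?I u - ?J u) has_vector_derivative trunc_conv 0 a b v x) (at x)"
      using 2 by (simp add: F0 clamp_real)
    then show ?thesis
      unfolding F
      by (rule has_vector_derivative_transform_within_open[of _ _ _ "{a<..<b}"])
        (use 2 in \<open>auto simp: clamp_real\<close>)
  next
    case 3
    have "((\<lambda>u. u *\<^sub>R ?I b - ?J b) has_vector_derivative trunc_conv 0 a b v x) (at x)"
      using 3 ab by (auto intro!: derivative_eq_intros simp: F0 clamp_real)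
    then show ?thesis
      unfolding F
      by (rule has_vector_derivative_transform_within_open[of _ _ _ "{b<..}"])
        (use 3 ab in \<open>auto simp: clamp_real\<close>)
  qed
qed

text \<open>For exponents at least 2 the kernel is continuously differentiable in \<open>x\<close>, so one can
  differentiate under the integral sign.\<close>

lemma has_vector_derivative_trunc_conv_Suc_Suc:
  "(trunc_conv (Suc (Suc j)) a b v has_vector_derivative trunc_conv (Suc j) a b v x) (at x)"
proof -
  have "((\<lambda>x. integral (cbox a b) (\<lambda>s. trunc_pow (Suc (Suc j)) (x - s) *\<^sub>R v s)) has_vector_derivative
      integral (cbox a b) (\<lambda>s. trunc_pow (Suc j) (x - s) *\<^sub>R v s)) (at x within UNIV)"
  proof (rule leibniz_rule_vector_derivative)
    show "((\<lambda>x. trunc_pow (Suc (Suc j)) (x - s) *\<^sub>R v s) has_vector_derivative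
        trunc_pow (Suc j) (x - s) *\<^sub>R v s) (at x within UNIV)" for x s
      by (simp add: has_vector_derivative_trunc_pow_shift)
    show "(\<lambda>s. trunc_pow (Suc (Suc j)) (x - s) *\<^sub>R v s) integrable_on cbox a b" for x
      using trunc_conv_integrable by simp
    have "continuous_on (UNIV \<times> cbox a b) (\<lambda>p. trunc_pow (Suc j) (fst p - snd p) *\<^sub>R v (snd p))"
      by (intro continuous_on_scaleR continuous_on_compose2[OF continuous_on_trunc_pow]
          continuous_on_compose2[OF v] continuous_intros) auto
    then show "continuous_on (UNIV \<times> cbox a b) (\<lambda>(x, s). trunc_pow (Suc j) (x - s) *\<^sub>R v s)"
      by (simp add: case_prod_beta)
  qed auto
  then show ?thesis unfolding trunc_conv_def by simp
qed

lemma has_vector_derivative_trunc_conv_Suc: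
  assumes "a < b" "j = 0 \<longrightarrow> x \<noteq> a \<and> x \<noteq> b"
  shows "(trunc_conv (Suc j) a b v has_vector_derivative trunc_conv j a b v x) (at x)"
  using assms has_vector_derivative_trunc_conv_1 has_vector_derivative_trunc_conv_Suc_Suc
  by (cases j) auto

lemma continuous_on_trunc_conv:
  assumes ab: "a \<le> b"
  shows "continuous_on S (trunc_conv j a b v)"
proof -
  have v': "continuous_on {a..b} (\<lambda>s. s *\<^sub>R v s)" by (intro continuous_intros v)
  have "continuous_on S (\<lambda>x. integral {a..clamp a b x} g)"
    if "continuous_on {a..b} g" for g :: "real \<Rightarrow> 'v"
    using clamp_continuous_on[where f = "\<lambda>u. integral {a..u} g" and a = a and b = b and S = S]
    by (simp add: cbox_interval indefinite_integral_continuous_1 integrable_continuous_interval that)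
  note I = this[OF v] this[OF v']
  consider "j = 0" | "j = 1" | "j \<ge> 2" by linarith
  then show ?thesis
  proof cases
    case 1 then show ?thesis using I by (simp add: trunc_conv_0_eq[OF ab])
  next
    case 2
    show ?thesis unfolding 2 trunc_conv_1_eq[OF ab] by (intro continuous_intros I)
  next
    case 3
    then obtain i where "j = Suc (Suc i)" by (metis add_2_eq_Suc le_Suc_ex)
    then show ?thesis
      by (metis continuous_at_imp_continuous_on has_vector_derivative_continuous
          has_vector_derivative_trunc_conv_Suc_Suc)
  qed
qed

end

lemma sum_trunc_pow_truncate:
  assumes "K \<le> M" "\<And>j. K < j \<Longrightarrow> r \<le> (real j - 1) * \<tau>"
  shows "(\<Sum>j\<le>M. trunc_pow j (r - (real j - 1) * \<tau>) *\<^sub>R C j)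
    = (\<Sum>j\<le>K. trunc_pow j (r - (real j - 1) * \<tau>) *\<^sub>R (C j :: 'a::real_vector))"
proof (rule sum.mono_neutral_right)
  show "\<forall>j\<in>{..M} - {..K}. trunc_pow j (r - (real j - 1) * \<tau>) *\<^sub>R C j = 0"
  proof
    fix j assume "j \<in> {..M} - {..K}"
    then have "r - (real j - 1) * \<tau> < 0 \<or> (r - (real j - 1) * \<tau> = 0 \<and> j > 0)"
      using assms(2)[of j] by auto
    then show "trunc_pow j (r - (real j - 1) * \<tau>) *\<^sub>R C j = 0" by simp
  qed
qed (use assms in auto)

lemma delay_exp_pos_eq_sum:
  fixes B :: "complex^'n::finite^'n"
  assumes tau: "\<tau> > 0" and r: "r > 0"
  shows "delay_exp \<tau> B r = (\<Sum>j\<le>nat \<lceil>r / \<tau>\<rceil>. trunc_pow j (r - (real j - 1) * \<tau>) *\<^sub>R mpow B j)"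
proof -
  have "real (nat \<lceil>r / \<tau>\<rceil>) - 1 < r / \<tau>"
    using ceiling_correct[of "r / \<tau>"] r tau by auto
  then have K: "(real (nat \<lceil>r / \<tau>\<rceil>) - 1) * \<tau> < r"
    using tau by (simp add: pos_less_divide_eq)
  have "r - (real j - 1) * \<tau> > 0" if "j \<le> nat \<lceil>r / \<tau>\<rceil>" for j
    using K order.strict_trans1[OF mult_right_mono[of "real j - 1" "real (nat \<lceil>r / \<tau>\<rceil>) - 1" \<tau>]]
      that tau by simp
  then show ?thesis using r tau by (simp add: delay_exp_def)
qed

lemma delay_exp_eq_sum:
  fixes B :: "complex^'n::finite^'n"
  assumes tau: "\<tau> > 0" and r: "r \<le> real M * \<tau>"
  shows "delay_exp \<tau> B r = (\<Sum>j\<le>M. trunc_pow j (r - (real j - 1) * \<tau>) *\<^sub>R mpow B j)"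
proof -
  consider "r < -\<tau>" | "-\<tau> \<le> r" "r \<le> 0" | "r > 0" by linarith
  then show ?thesis
  proof cases
    case 1
    have "trunc_pow j (r - (real j - 1) * \<tau>) = 0" for j
    proof -
      have "0 \<le> real j * \<tau>" using tau by simp
      then have "r - (real j - 1) * \<tau> < 0" using 1 by (simp add: algebra_simps)
      then show ?thesis by simp
    qed
    then show ?thesis using 1 by (simp add: delay_exp_def)
  next
    case 2
    have "r \<le> (real j - 1) * \<tau>" if "0 < j" for j
    proof -
      have "0 \<le> (real j - 1) * \<tau>" using that tau by simp
      then show ?thesis using 2 by linarith
    qed
    then have "(\<Sum>j\<le>M. trunc_pow j (r - (real j - 1) * \<tau>) *\<^sub>R mpow B j) = trunc_pow 0 (r + \<tau>) *\<^sub>R mat 1"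
      by (subst sum_trunc_pow_truncate[of 0]) simp_all
    then show ?thesis using 2 by (simp add: delay_exp_def trunc_pow_def)
  next
    case 3
    let ?K = "nat \<lceil>r / \<tau>\<rceil>"
    have "r / \<tau> \<le> real ?K" using le_of_int_ceiling[of "r / \<tau>"] 3 tau by simp
    then have "r \<le> real ?K * \<tau>" using tau by (simp add: pos_divide_le_eq)
    moreover have "real ?K * \<tau> \<le> (real j - 1) * \<tau>" if "?K < j" for j
      using that tau by (intro mult_right_mono) linarith+
    ultimately have "r \<le> (real j - 1) * \<tau>" if "?K < j" for j
      using that by (meson order.trans)
    moreover have "?K \<le> M"
      using r tau by (simp add: pos_divide_le_eq ceiling_le_iff nat_le_iff)
    ultimately show ?thesis
      unfolding delay_exp_pos_eq_sum[OF tau 3] by (intro sum_trunc_pow_truncate[symmetric])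
  qed
qed

lemma delay_exp_commute:
  assumes "B ** M = M ** B"
  shows "delay_exp \<tau> B r ** M = M ** (delay_exp \<tau> B r :: complex^'n::finite^'n)"
  unfolding delay_exp_def
  by (simp add: sum_matrix_mult_left sum_matrix_mult_right scalar_matrix_assoc[symmetric]
      matrix_scalar_ac mpow_commute[OF assms])

lemma has_integral_sum_trunc_conv:
  fixes M :: "nat \<Rightarrow> complex^'n::finite^'n" and g :: "real \<Rightarrow> complex^'n"
  assumes g: "continuous_on {a..b} g"
  shows "((\<lambda>s. \<Sum>j\<le>K. M j *v (trunc_pow j (c j - s) *\<^sub>R g s))
    has_integral (\<Sum>j\<le>K. M j *v trunc_conv j a b g (c j))) {a..b}"
proof (rule has_integral_sum)
  fix j
  have "((\<lambda>s. trunc_pow j (c j - s) *\<^sub>R g s) has_integral trunc_conv j a b g (c j)) {a..b}"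
    unfolding trunc_conv_def using trunc_conv_integrable[OF g] by (rule integrable_integral)
  from has_integral_linear[OF this matrix_vector_mul_bounded_linear[of "M j"]]
  show "((\<lambda>s. M j *v (trunc_pow j (c j - s) *\<^sub>R g s))
      has_integral M j *v trunc_conv j a b g (c j)) {a..b}"
    by (simp add: o_def)
qed simp

lemma has_vector_derivative_zero_eq_on_interval:
  fixes d :: "real \<Rightarrow> 'a::banach"
  assumes "continuous_on {a..b} d" "\<And>r. a < r \<Longrightarrow> r < b \<Longrightarrow> (d has_vector_derivative 0) (at r)"
    and "s \<in> {a..b}"
  shows "d s = d a"
  by (rule has_derivative_zero_unique_strong_interval[of "{a, b}"])
    (use assms in \<open>auto simp: has_vector_derivative_def intro: has_derivative_at_withinI\<close>)

text \<open>The formula of the theorem for the first block in the case \<open>A = 0\<close>.\<close>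

definition delay_formula ::
  "real \<Rightarrow> complex^'n^'n \<Rightarrow> (real \<Rightarrow> complex^'n) \<Rightarrow> (real \<Rightarrow> complex^'n) \<Rightarrow> real \<Rightarrow> complex^'n"
  where "delay_formula \<tau> B \<psi> w t = delay_exp \<tau> B (t - \<tau>) *v \<psi> 0
     + integral {-\<tau>..0} (\<lambda>s. (delay_exp \<tau> B (t - 2 * \<tau> - s) ** B) *v \<psi> s)
     + integral {0..t} (\<lambda>s. delay_exp \<tau> B (t - \<tau> - s) *v w s)"

text \<open>The coefficient of \<open>B\<^sup>j\<close> in \<^const>\<open>delay_formula\<close>; it is differentiated termwise.\<close>

definition delay_formula_coeff ::
  "real \<Rightarrow> complex^'n^'n \<Rightarrow> (real \<Rightarrow> complex^'n) \<Rightarrow> (real \<Rightarrow> complex^'n) \<Rightarrow> nat \<Rightarrow> real \<Rightarrow> complex^'n"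
  where "delay_formula_coeff \<tau> B \<psi> w j t = trunc_pow j (t - real j * \<tau>) *\<^sub>R \<psi> 0
     + trunc_conv j (-\<tau>) 0 (\<lambda>s. B *v \<psi> s) (t - (real j + 1) * \<tau>)
     + trunc_conv j 0 t w (t - real j * \<tau>)"

context
  fixes \<tau> :: real and B :: "complex^'n::finite^'n" and \<psi> w :: "real \<Rightarrow> complex^'n"
  assumes tau: "\<tau> > 0" and \<psi>: "continuous_on UNIV \<psi>" and w: "continuous_on UNIV w"
begin

lemma continuous_on_delay_data: "continuous_on S (\<lambda>s. B *v \<psi> s)" "continuous_on S w"
  by (rule bounded_linear.continuous_on[OF matrix_vector_mul_bounded_linear
        continuous_on_subset[OF \<psi> subset_UNIV]], rule continuous_on_subset[OF w subset_UNIV])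

lemma has_integral_delay_formula:
  assumes M: "t \<le> real M * \<tau>"
  shows "((\<lambda>s. (delay_exp \<tau> B (t - 2 * \<tau> - s) ** B) *v \<psi> s) has_integral
      (\<Sum>j\<le>M. mpow B j *v trunc_conv j (-\<tau>) 0 (\<lambda>s. B *v \<psi> s) (t - (real j + 1) * \<tau>))) {-\<tau>..0}"
    and "((\<lambda>s. delay_exp \<tau> B (t - \<tau> - s) *v w s) has_integral
      (\<Sum>j\<le>M. mpow B j *v trunc_conv j 0 t w (t - real j * \<tau>))) {0..t}"
proof -
  have expand: "delay_exp \<tau> B (t - c - s)
      = (\<Sum>j\<le>M. trunc_pow j (t - c - s - (real j - 1) * \<tau>) *\<^sub>R mpow B j)"
    if "c \<ge> \<tau>" "s \<ge> -\<tau>" "c - \<tau> \<ge> 0 \<or> s \<ge> 0" for c s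
    by (rule delay_exp_eq_sum[OF tau]) (use that M in auto)
  show "((\<lambda>s. (delay_exp \<tau> B (t - 2 * \<tau> - s) ** B) *v \<psi> s) has_integral
      (\<Sum>j\<le>M. mpow B j *v trunc_conv j (-\<tau>) 0 (\<lambda>s. B *v \<psi> s) (t - (real j + 1) * \<tau>))) {-\<tau>..0}"
    using has_integral_sum_trunc_conv[OF continuous_on_delay_data(1), where K = M and
        M = "mpow B" and c = "\<lambda>j. t - (real j + 1) * \<tau>"]
  proof (rule has_integral_eq[rotated])
    fix s :: real assume s: "s \<in> {-\<tau>..0}"
    show "(\<Sum>j\<le>M. mpow B j *v (trunc_pow j (t - (real j + 1) * \<tau> - s) *\<^sub>R (B *v \<psi> s)))
        = (delay_exp \<tau> B (t - 2 * \<tau> - s) ** B) *v \<psi> s"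
      using expand[of "2 * \<tau>" s] s tau
      by (simp add: sum_matrix_mult_left sum_matrix_vector_mult_left scalar_matrix_assoc[symmetric]
          scaleR_matrix_vector_left scaleR_matrix_vector_right matrix_vector_mul_assoc
          algebra_simps)
  qed
  show "((\<lambda>s. delay_exp \<tau> B (t - \<tau> - s) *v w s) has_integral
      (\<Sum>j\<le>M. mpow B j *v trunc_conv j 0 t w (t - real j * \<tau>))) {0..t}"
    using has_integral_sum_trunc_conv[OF continuous_on_delay_data(2), where K = M and
        M = "mpow B" and c = "\<lambda>j. t - real j * \<tau>"]
  proof (rule has_integral_eq[rotated])
    fix s :: real assume s: "s \<in> {0..t}"
    show "(\<Sum>j\<le>M. mpow B j *v (trunc_pow j (t - real j * \<tau> - s) *\<^sub>R w s))
        = delay_exp \<tau> B (t - \<tau> - s) *v w s"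
      using expand[of \<tau> s] s tau
      by (simp add: sum_matrix_vector_mult_left scaleR_matrix_vector_left
          scaleR_matrix_vector_right algebra_simps)
  qed
qed

lemma delay_formula_eq_sum:
  assumes M: "t \<le> real M * \<tau>"
  shows "delay_formula \<tau> B \<psi> w t = (\<Sum>j\<le>M. mpow B j *v delay_formula_coeff \<tau> B \<psi> w j t)"
proof -
  have "delay_exp \<tau> B (t - \<tau>) = (\<Sum>j\<le>M. trunc_pow j (t - \<tau> - (real j - 1) * \<tau>) *\<^sub>R mpow B j)"
    by (rule delay_exp_eq_sum[OF tau]) (use M tau in auto)
  then have "delay_exp \<tau> B (t - \<tau>) *v \<psi> 0 = (\<Sum>j\<le>M. mpow B j *v (trunc_pow j (t - real j * \<tau>) *\<^sub>R \<psi> 0))"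
    by (simp add: sum_matrix_vector_mult_left scaleR_matrix_vector_left scaleR_matrix_vector_right
        algebra_simps)
  then show ?thesis
    unfolding delay_formula_def delay_formula_coeff_def
      integral_unique[OF has_integral_delay_formula(1)[OF M]]
      integral_unique[OF has_integral_delay_formula(2)[OF M]]
    by (simp add: sum.distrib[symmetric] matrix_vector_right_distrib)
qed

lemma trunc_conv_upper_cong:
  "x \<le> b \<Longrightarrow> x \<le> b' \<Longrightarrow> trunc_conv j 0 b w x = trunc_conv j 0 b' w x"
  using trunc_conv_eq[OF continuous_on_delay_data(2), of j 0 b x]
    trunc_conv_eq[OF continuous_on_delay_data(2), of j 0 b' x] by simp

text \<open>Near \<open>t\<close>, the upper limit \<open>t\<close> of the last convolution in the coefficient may be replaced
  by a constant \<open>T > t\<close>, which makes it differentiable.\<close>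

lemma delay_formula_coeff_eq_local:
  "t' < T \<Longrightarrow> delay_formula_coeff \<tau> B \<psi> w j t' = trunc_pow j (t' - real j * \<tau>) *\<^sub>R \<psi> 0
     + trunc_conv j (-\<tau>) 0 (\<lambda>s. B *v \<psi> s) (t' - (real j + 1) * \<tau>)
     + trunc_conv j 0 T w (t' - real j * \<tau>)"
proof -
  assume "t' < T"
  moreover have "0 \<le> real j * \<tau>" using tau by simp
  ultimately show ?thesis
    using trunc_conv_upper_cong[of "t' - real j * \<tau>" t' T j] by (simp add: delay_formula_coeff_def)
qed

lemma has_vector_derivative_delay_formula_coeff_Suc:
  assumes t: "0 < t" "\<forall>m::nat. t \<noteq> real m * \<tau>"
  shows "(delay_formula_coeff \<tau> B \<psi> w (Suc j) has_vector_derivative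
      delay_formula_coeff \<tau> B \<psi> w j (t - \<tau>)) (at t)"
proof -
  have tt: "t \<noteq> \<tau>" "t \<noteq> 2 * \<tau>" using t(2)[rule_format, of 1] t(2)[rule_format, of 2] by auto
  have d1: "((\<lambda>t'. trunc_pow (Suc j) (t' - real (Suc j) * \<tau>) *\<^sub>R \<psi> 0) has_vector_derivative
      trunc_pow j (t - real (Suc j) * \<tau>) *\<^sub>R \<psi> 0) (at t)"
    by (rule has_vector_derivative_trunc_pow_shift) (use tt in auto)
  have d2: "((\<lambda>t'. trunc_conv (Suc j) (-\<tau>) 0 (\<lambda>s. B *v \<psi> s) (t' - (real (Suc j) + 1) * \<tau>))
      has_vector_derivative trunc_conv j (-\<tau>) 0 (\<lambda>s. B *v \<psi> s) (t - (real (Suc j) + 1) * \<tau>)) (at t)"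
    by (rule has_vector_derivative_shift_minus,
        rule has_vector_derivative_trunc_conv_Suc[OF continuous_on_delay_data(1)])
      (use tt tau in \<open>auto simp: algebra_simps\<close>)
  have d3: "((\<lambda>t'. trunc_conv (Suc j) 0 (t + 1) w (t' - real (Suc j) * \<tau>))
      has_vector_derivative trunc_conv j 0 (t + 1) w (t - real (Suc j) * \<tau>)) (at t)"
    by (rule has_vector_derivative_shift_minus,
        rule has_vector_derivative_trunc_conv_Suc[OF continuous_on_delay_data(2)])
      (use tt t tau in \<open>auto simp: algebra_simps\<close>)
  have "trunc_pow j (t - real (Suc j) * \<tau>) *\<^sub>R \<psi> 0
     + trunc_conv j (-\<tau>) 0 (\<lambda>s. B *v \<psi> s) (t - (real (Suc j) + 1) * \<tau>)
     + trunc_conv j 0 (t + 1) w (t - real (Suc j) * \<tau>) = delay_formula_coeff \<tau> B \<psi> w j (t - \<tau>)"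
    using delay_formula_coeff_eq_local[of "t - \<tau>" "t + 1" j] tau by (simp add: algebra_simps)
  with has_vector_derivative_add[OF has_vector_derivative_add[OF d1 d2] d3]
  have d: "((\<lambda>t'. trunc_pow (Suc j) (t' - real (Suc j) * \<tau>) *\<^sub>R \<psi> 0
     + trunc_conv (Suc j) (-\<tau>) 0 (\<lambda>s. B *v \<psi> s) (t' - (real (Suc j) + 1) * \<tau>)
     + trunc_conv (Suc j) 0 (t + 1) w (t' - real (Suc j) * \<tau>)) has_vector_derivative
      delay_formula_coeff \<tau> B \<psi> w j (t - \<tau>)) (at t)"
    by simp
  show ?thesis
    by (rule has_vector_derivative_transform_within_open[OF d, of "{..<t + 1}"])
      (simp_all add: delay_formula_coeff_eq_local)
qed

lemma has_vector_derivative_delay_formula_coeff_0: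
  assumes t: "0 < t" "\<forall>m::nat. t \<noteq> real m * \<tau>"
  shows "(delay_formula_coeff \<tau> B \<psi> w 0 has_vector_derivative
      (if t < \<tau> then B *v \<psi> (t - \<tau>) else 0) + w t) (at t)"
proof -
  have "t \<noteq> \<tau>" using t(2)[rule_format, of 1] by auto
  have d1: "((\<lambda>t'. trunc_pow 0 (t' - 0) *\<^sub>R \<psi> 0) has_vector_derivative 0) (at t)"
    by (rule has_vector_derivative_trunc_pow_0_shift) (use t in auto)
  have d2: "((\<lambda>t'. trunc_conv 0 (-\<tau>) 0 (\<lambda>s. B *v \<psi> s) (t' - \<tau>)) has_vector_derivative
      (if -\<tau> < t - \<tau> \<and> t - \<tau> < 0 then B *v \<psi> (t - \<tau>) else 0)) (at t)"
    by (rule has_vector_derivative_shift_minus,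
        rule has_vector_derivative_trunc_conv_0[OF continuous_on_delay_data(1)])
      (use \<open>t \<noteq> \<tau>\<close> t tau in auto)
  have d3: "((\<lambda>t'. trunc_conv 0 0 (t + 1) w (t' - 0)) has_vector_derivative
      (if 0 < t - 0 \<and> t - 0 < t + 1 then w (t - 0) else 0)) (at t)"
    by (rule has_vector_derivative_shift_minus,
        rule has_vector_derivative_trunc_conv_0[OF continuous_on_delay_data(2)]) (use t in auto)
  have d: "((\<lambda>t'. trunc_pow 0 (t' - 0) *\<^sub>R \<psi> 0 + trunc_conv 0 (-\<tau>) 0 (\<lambda>s. B *v \<psi> s) (t' - \<tau>)
      + trunc_conv 0 0 (t + 1) w (t' - 0)) has_vector_derivative
      (if t < \<tau> then B *v \<psi> (t - \<tau>) else 0) + w t) (at t)"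
    using has_vector_derivative_add[OF has_vector_derivative_add[OF d1 d2] d3] t by simp
  show ?thesis
    by (rule has_vector_derivative_transform_within_open[OF d, of "{..<t + 1}"])
      (use delay_formula_coeff_eq_local[of _ "t + 1" 0] in simp_all)
qed

lemma has_vector_derivative_delay_formula:
  assumes t: "0 < t" "\<forall>m::nat. t \<noteq> real m * \<tau>"
  shows "(delay_formula \<tau> B \<psi> w has_vector_derivative
      (if t < \<tau> then B *v \<psi> (t - \<tau>) else 0) + w t + B *v delay_formula \<tau> B \<psi> w (t - \<tau>)) (at t)"
proof -
  obtain M :: nat where M: "t + 1 \<le> real M * \<tau>"
    using real_arch_simple[of "(t + 1) / \<tau>"] tau by (auto simp: pos_divide_le_eq)
  let ?c = "delay_formula_coeff \<tau> B \<psi> w"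
  have "((\<lambda>t'. \<Sum>j\<le>Suc M. mpow B j *v ?c j t') has_vector_derivative
      mpow B 0 *v ((if t < \<tau> then B *v \<psi> (t - \<tau>) else 0) + w t)
      + (\<Sum>j\<le>M. mpow B (Suc j) *v ?c j (t - \<tau>))) (at t)"
    unfolding sum.atMost_Suc_shift
    by (intro has_vector_derivative_add has_vector_derivative_sum
        bounded_linear.has_vector_derivative[OF matrix_vector_mul_bounded_linear]
        has_vector_derivative_delay_formula_coeff_0 has_vector_derivative_delay_formula_coeff_Suc t)
  moreover have "(\<Sum>j\<le>M. mpow B (Suc j) *v ?c j (t - \<tau>)) = B *v delay_formula \<tau> B \<psi> w (t - \<tau>)"
    using M tau
    by (simp add: delay_formula_eq_sum[of "t - \<tau>" M] vec.sum mpow_Suc matrix_vector_mul_assoc)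
  ultimately have d: "((\<lambda>t'. \<Sum>j\<le>Suc M. mpow B j *v ?c j t') has_vector_derivative
      (if t < \<tau> then B *v \<psi> (t - \<tau>) else 0) + w t + B *v delay_formula \<tau> B \<psi> w (t - \<tau>)) (at t)"
    by simp
  have "delay_formula \<tau> B \<psi> w t' = (\<Sum>j\<le>Suc M. mpow B j *v ?c j t')" if "t' < t + 1" for t'
    by (rule delay_formula_eq_sum) (use that M tau in \<open>simp add: distrib_right\<close>)
  then show ?thesis
    by (rule has_vector_derivative_transform_within_open[OF d, of "{..<t + 1}", rotated 2,
          OF sym]) simp_all
qed

lemma delay_formula_neg:
  assumes "t < 0"
  shows "delay_formula \<tau> B \<psi> w t = 0"
proof -
  have "integral {-\<tau>..0} (\<lambda>s. (delay_exp \<tau> B (t - 2 * \<tau> - s) ** B) *v \<psi> s) = integral {-\<tau>..0} (\<lambda>s. 0)"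
    by (rule integral_cong) (use assms tau in \<open>auto simp: delay_exp_def\<close>)
  then show ?thesis using assms tau by (simp add: delay_formula_def delay_exp_def)
qed

lemma delay_formula_0: "delay_formula \<tau> B \<psi> w 0 = \<psi> 0"
proof -
  have "integral {-\<tau>..0} (\<lambda>s. (delay_exp \<tau> B (0 - 2 * \<tau> - s) ** B) *v \<psi> s) = integral {-\<tau>..0} (\<lambda>s. 0)"
    by (rule integral_spike[of "{-\<tau>}"]) (use tau in \<open>auto simp: delay_exp_def\<close>)
  then show ?thesis using tau by (simp add: delay_formula_def delay_exp_def)
qed

lemma continuous_on_delay_formula:
  assumes "0 \<le> T"
  shows "continuous_on {0..T} (delay_formula \<tau> B \<psi> w)"
proof -
  obtain M :: nat where M: "T \<le> real M * \<tau>"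
    using real_arch_simple[of "T / \<tau>"] tau by (auto simp: pos_divide_le_eq)
  have "continuous_on {0..T} (delay_formula_coeff \<tau> B \<psi> w j)" for j
  proof -
    have "continuous_on {0..T} (\<lambda>t. trunc_pow j (t - real j * \<tau>) *\<^sub>R \<psi> 0)"
    proof (cases j)
      case 0
      show ?thesis
        by (rule continuous_on_eq[OF continuous_on_const[of _ "\<psi> 0"]]) (simp add: 0 trunc_pow_def)
    next
      case (Suc i)
      then show ?thesis
        by (intro continuous_intros continuous_on_compose2[OF continuous_on_trunc_pow[of j UNIV]])
          auto
    qed
    moreover have "continuous_on {0..T} (\<lambda>t. trunc_conv j (-\<tau>) 0 (\<lambda>s. B *v \<psi> s) (t - (real j + 1) * \<tau>))"
      using tau
      by (intro continuous_on_compose2[OF continuous_on_trunc_conv[OF continuous_on_delay_data(1)]]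
          continuous_intros) auto
    moreover have "continuous_on {0..T} (\<lambda>t. trunc_conv j 0 (T + 1) w (t - real j * \<tau>))"
      using assms
      by (intro continuous_on_compose2[OF continuous_on_trunc_conv[OF continuous_on_delay_data(2)]]
          continuous_intros) auto
    ultimately have "continuous_on {0..T} (\<lambda>t. trunc_pow j (t - real j * \<tau>) *\<^sub>R \<psi> 0
        + trunc_conv j (-\<tau>) 0 (\<lambda>s. B *v \<psi> s) (t - (real j + 1) * \<tau>)
        + trunc_conv j 0 (T + 1) w (t - real j * \<tau>))"
      by (intro continuous_on_add)
    then show ?thesis
      by (rule continuous_on_eq) (simp add: delay_formula_coeff_eq_local[of _ "T + 1"])
  qed
  then have "continuous_on {0..T} (\<lambda>t. \<Sum>j\<le>M. mpow B j *v delay_formula_coeff \<tau> B \<psi> w j t)"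
    by (intro continuous_on_sum bounded_linear.continuous_on[OF matrix_vector_mul_bounded_linear])
  then show ?thesis
    by (rule continuous_on_eq) (use M in \<open>simp add: delay_formula_eq_sum[of _ M]\<close>)
qed

text \<open>Method of steps: \<open>d = u - delay_formula \<tau> B \<psi> w\<close> has derivative \<open>B d(t - \<tau>)\<close> for
  \<open>t > \<tau>\<close> and 0 for \<open>t < \<tau>\<close>, so it vanishes on one interval \<open>[j\<tau>, (j + 1)\<tau>]\<close> after the other.\<close>

lemma has_vector_derivative_diff_delay_formula:
  assumes de: "(u has_vector_derivative B *v u (t - \<tau>) + w t) (at t)"
    and t: "t > 0" "\<forall>m::nat. t \<noteq> real m * \<tau>"
  shows "((\<lambda>t. u t - delay_formula \<tau> B \<psi> w t) has_vector_derivative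
    B *v (u (t - \<tau>) - (if t < \<tau> then \<psi> (t - \<tau>) else delay_formula \<tau> B \<psi> w (t - \<tau>)))) (at t)"
proof -
  have "((\<lambda>t. u t - delay_formula \<tau> B \<psi> w t) has_vector_derivative (B *v u (t - \<tau>) + w t) -
      ((if t < \<tau> then B *v \<psi> (t - \<tau>) else 0) + w t + B *v delay_formula \<tau> B \<psi> w (t - \<tau>))) (at t)"
    by (intro has_vector_derivative_diff de has_vector_derivative_delay_formula t)
  then show ?thesis
    by (cases "t < \<tau>") (simp_all add: delay_formula_neg matrix_vector_mult_diff_distrib)
qed

lemma delay_formula_unique:
  assumes u: "continuous_on {-\<tau>..} u" and init: "\<And>s. s \<in> {-\<tau>..0} \<Longrightarrow> u s = \<psi> s"
    and de: "\<And>t. t > 0 \<Longrightarrow> (\<forall>m::nat. t \<noteq> real m * \<tau>) \<Longrightarrow>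
      (u has_vector_derivative B *v u (t - \<tau>) + w t) (at t)"
    and t: "t \<ge> 0"
  shows "u t = delay_formula \<tau> B \<psi> w t"
proof -
  define d where "d = (\<lambda>t. u t - delay_formula \<tau> B \<psi> w t)"
  note d' = has_vector_derivative_diff_delay_formula[OF de, folded d_def]
  have d_cont: "continuous_on {real j * \<tau> .. (real j + 1) * \<tau>} d" for j :: nat
  proof -
    have "-\<tau> \<le> real j * \<tau>" by (rule order.trans[of _ 0]) (use tau in auto)
    then show ?thesis
      unfolding d_def
      by (intro continuous_on_diff continuous_on_subset[OF u]
          continuous_on_subset[OF continuous_on_delay_formula[of "(real j + 1) * \<tau>"]]) (use tau in auto)
  qed
  have d0: "d s = 0" if "s \<in> {real j * \<tau> .. (real j + 1) * \<tau>}" for j :: nat and s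
    using that
  proof (induction j arbitrary: s)
    case 0
    have "d s = d 0"
    proof (rule has_vector_derivative_zero_eq_on_interval[OF d_cont[of 0, simplified]])
      fix r assume r: "0 < r" "r < \<tau>"
      then have "(d has_vector_derivative B *v (u (r - \<tau>) - \<psi> (r - \<tau>))) (at r)"
        using d'[of r] not_grid_point_between[OF tau, of 0 r] by auto
      with r show "(d has_vector_derivative 0) (at r)" using init[of "r - \<tau>"] by simp
    qed (use 0 in simp)
    also have "d 0 = 0" using init[of 0] tau by (simp add: d_def delay_formula_0)
    finally show ?case .
  next
    case (Suc j)
    let ?a = "real (Suc j) * \<tau>" and ?b = "(real (Suc j) + 1) * \<tau>"
    have "d s = d ?a"
    proof (rule has_vector_derivative_zero_eq_on_interval[OF d_cont[of "Suc j"]])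
      fix r assume r: "?a < r" "r < ?b"
      have "\<tau> \<le> ?a" using tau by simp
      with r have "\<tau> < r" by auto
      with r have "(d has_vector_derivative B *v d (r - \<tau>)) (at r)"
        using d'[of r] not_grid_point_between[OF tau, of "Suc j" r] tau by (auto simp: d_def)
      moreover have "d (r - \<tau>) = 0"
        using r by (intro Suc.IH) (auto simp: algebra_simps)
      ultimately show "(d has_vector_derivative 0) (at r)" by simp
    qed (use Suc.prems in simp)
    also have "d ?a = 0" using Suc.IH[of ?a] tau by (simp add: algebra_simps)
    finally show ?case .
  qed
  obtain j :: nat where "real j * \<tau> \<le> t" "t < (real j + 1) * \<tau>"
    using grid_interval_exists[OF tau t] .
  then have "d t = 0" by (intro d0[of _ j]) simp
  then show ?thesis by (simp add: d_def)
qed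

end

section \<open>The differential block\<close>

lemma integral_matrix_vector_mult:
  "f integrable_on S \<Longrightarrow> integral S (\<lambda>s. M *v f s) = M *v integral S (f :: real \<Rightarrow> complex^'n::finite)"
  using integral_linear[OF _ matrix_vector_mul_bounded_linear[of M]] by (simp add: o_def)

lemma has_vector_derivative_mexp_neg:
  "((\<lambda>s. mexp ((- s) *\<^sub>R A)) has_vector_derivative - (mexp ((- t) *\<^sub>R A) ** A)) (at t)"
  for A :: "complex^'n::finite^'n"
proof -
  have "((\<lambda>s. mexp (s *\<^sub>R A)) \<circ> uminus has_vector_derivative (- 1) *\<^sub>R (mexp ((- t) *\<^sub>R A) ** A)) (at t)"
    by (intro vector_diff_chain_at has_vector_derivative_mexp) (auto intro!: derivative_eq_intros)
  then show ?thesis by (simp add: o_def)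
qed

lemma continuous_on_mexp_neg: "continuous_on S (\<lambda>s. mexp ((- s) *\<^sub>R (A::complex^'n::finite^'n)))"
  by (rule continuous_at_imp_continuous_on)
    (use has_vector_derivative_continuous[OF has_vector_derivative_mexp_neg] in blast)

lemma continuous_on_mexp_neg_matrix_vector_mult:
  "continuous_on S g \<Longrightarrow> continuous_on S (\<lambda>s. mexp ((- s) *\<^sub>R A) *v (g s :: complex^'n::finite))"
  by (rule bounded_bilinear.continuous_on[OF bounded_bilinear_matrix_vector_mult
        continuous_on_mexp_neg])

text \<open>Variation of constants: \<open>u(s) = e\<^sup>-\<^sup>A\<^sup>s x(s)\<close> solves the pure delay equation
  \<open>u' = B\<^sub>h u(t - \<tau>) + e\<^sup>-\<^sup>A\<^sup>t f(t)\<close> with \<open>B\<^sub>h = e\<^sup>-\<^sup>A\<^sup>\<tau> B\<close>, because \<open>A\<close> and \<open>B\<close> commute.\<close>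

lemma ddae_solution_variation_of_constants:
  fixes A B :: "complex^'n::finite^'n"
  assumes tau: "\<tau> > 0" and AB: "A ** B = B ** A"
    and \<phi>: "continuous_on UNIV \<phi>" and f: "continuous_on UNIV f"
    and x: "ddae_solution (mat 1) A B \<tau> f \<phi> x" and t: "t \<ge> 0"
  shows "mexp ((- t) *\<^sub>R A) *v x t = delay_formula \<tau> (mexp ((- \<tau>) *\<^sub>R A) ** B)
    (\<lambda>s. mexp ((- s) *\<^sub>R A) *v \<phi> s) (\<lambda>s. mexp ((- s) *\<^sub>R A) *v f s) t"
proof (rule delay_formula_unique[OF tau continuous_on_mexp_neg_matrix_vector_mult[OF \<phi>]
      continuous_on_mexp_neg_matrix_vector_mult[OF f] _ _ _ t])
  show "continuous_on {-\<tau>..} (\<lambda>s. mexp ((- s) *\<^sub>R A) *v x s)"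
    by (rule continuous_on_mexp_neg_matrix_vector_mult[OF ddae_solutionD(1)[OF x]])
  show "mexp ((- s) *\<^sub>R A) *v x s = mexp ((- s) *\<^sub>R A) *v \<phi> s" if "s \<in> {-\<tau>..0}" for s
    using ddae_solutionD(2)[OF x that] by simp
  fix t assume t: "t > 0" "\<forall>m::nat. t \<noteq> real m * \<tau>"
  have "(x has_vector_derivative A *v x t + B *v x (t - \<tau>) + f t) (at t)"
    using ddae_solutionD(3)[OF x] t by simp
  from bounded_bilinear.has_vector_derivative[OF bounded_bilinear_matrix_vector_mult
      has_vector_derivative_mexp_neg this]
  have "((\<lambda>s. mexp ((- s) *\<^sub>R A) *v x s) has_vector_derivative
      mexp ((- t) *\<^sub>R A) *v (A *v x t + B *v x (t - \<tau>) + f t)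
      + (- (mexp ((- t) *\<^sub>R A) ** A)) *v x t) (at t)"
    by simp
  moreover have "mexp ((- t) *\<^sub>R A) ** B = (mexp ((- \<tau>) *\<^sub>R A) ** B) ** mexp ((- (t - \<tau>)) *\<^sub>R A)"
    using mexp_add[of "- \<tau>" A "- (t - \<tau>)"] mexp_commute[OF AB, of "- (t - \<tau>)"]
    by (simp add: matrix_mul_assoc) (metis matrix_mul_assoc)
  ultimately show "((\<lambda>s. mexp ((- s) *\<^sub>R A) *v x s) has_vector_derivative
      (mexp ((- \<tau>) *\<^sub>R A) ** B) *v (mexp ((- (t - \<tau>)) *\<^sub>R A) *v x (t - \<tau>))
      + mexp ((- t) *\<^sub>R A) *v f t) (at t)"
    by (simp add: matrix_vector_right_distrib matrix_vector_mul_assoc matrix_vector_mult_uminus_left)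
qed

lemma mexp_mult_delay_formula:
  fixes A B :: "complex^'n::finite^'n"
  assumes tau: "\<tau> > 0" and AB: "A ** B = B ** A"
    and \<phi>: "continuous_on UNIV \<phi>" and f: "continuous_on UNIV f" and t: "t \<ge> 0"
  defines "Bh \<equiv> mexp ((- \<tau>) *\<^sub>R A) ** B"
  shows "mexp (t *\<^sub>R A) *v delay_formula \<tau> Bh
      (\<lambda>s. mexp ((- s) *\<^sub>R A) *v \<phi> s) (\<lambda>s. mexp ((- s) *\<^sub>R A) *v f s) t
    = (mexp (t *\<^sub>R A) ** delay_exp \<tau> Bh (t - \<tau>)) *v \<phi> 0
    + integral {-\<tau>..0} (\<lambda>s. (mexp ((t - s) *\<^sub>R A) ** delay_exp \<tau> Bh (t - 2 * \<tau> - s) ** Bh) *v \<phi> s)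
    + integral {0..t} (\<lambda>s. (mexp ((t - s) *\<^sub>R A) ** delay_exp \<tau> Bh (t - \<tau> - s)) *v f s)"
proof -
  let ?E = "\<lambda>r. mexp (r *\<^sub>R A)" and ?D = "delay_exp \<tau> Bh"
  have Bh_A: "Bh ** A = A ** Bh"
    unfolding Bh_def using mexp_commute[of A A "- \<tau>"] by (metis AB matrix_mul_assoc)
  have E_split: "?E (t - s) = ?E t ** ?E (- s)" for s using mexp_add[of t A "- s"] by simp
  have E_D: "?E r ** ?D q = ?D q ** ?E r" for r q
    using delay_exp_commute[OF mexp_commute[OF Bh_A[symmetric], symmetric]] by simp
  have E_Bh: "?E r ** Bh = Bh ** ?E r" for r by (rule mexp_commute[OF Bh_A[symmetric]])
  obtain M :: nat where M: "t \<le> real M * \<tau>"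
    using real_arch_simple[of "t / \<tau>"] tau by (auto simp: pos_divide_le_eq)
  have "continuous_on UNIV (\<lambda>s. ?E (- s) *v \<phi> s)" "continuous_on UNIV (\<lambda>s. ?E (- s) *v f s)"
    by (intro continuous_on_mexp_neg_matrix_vector_mult \<phi> f)+
  note integral = has_integral_delay_formula[OF tau this M, where B = Bh]
  have "?E t *v ((?D r ** Bh) *v (?E (- s) *v \<phi> s)) = (?E (t - s) ** ?D r ** Bh) *v \<phi> s" for r s
  proof -
    have "?E (t - s) ** ?D r ** Bh = ?E t ** (?E (- s) ** (?D r ** Bh))"
      by (simp add: E_split matrix_mul_assoc)
    also have "\<dots> = ?E t ** (?D r ** Bh ** ?E (- s))" by (metis E_D E_Bh matrix_mul_assoc)
    finally show ?thesis by (simp add: matrix_vector_mul_assoc)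
  qed
  then have int1: "?E t *v integral {-\<tau>..0} (\<lambda>s. (?D (t - 2 * \<tau> - s) ** Bh) *v (?E (- s) *v \<phi> s))
      = integral {-\<tau>..0} (\<lambda>s. (?E (t - s) ** ?D (t - 2 * \<tau> - s) ** Bh) *v \<phi> s)"
    using integral_matrix_vector_mult[OF has_integral_integrable[OF integral(1)], of "?E t"] by simp
  have "?E t *v (?D r *v (?E (- s) *v f s)) = (?E (t - s) ** ?D r) *v f s" for r s
  proof -
    have "?E (t - s) ** ?D r = ?E t ** (?E (- s) ** ?D r)" by (simp add: E_split matrix_mul_assoc)
    also have "\<dots> = ?E t ** (?D r ** ?E (- s))" by (simp only: E_D)
    finally show ?thesis by (simp add: matrix_vector_mul_assoc)
  qed
  then have int2: "?E t *v integral {0..t} (\<lambda>s. ?D (t - \<tau> - s) *v (?E (- s) *v f s))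
      = integral {0..t} (\<lambda>s. (?E (t - s) ** ?D (t - \<tau> - s)) *v f s)"
    using integral_matrix_vector_mult[OF has_integral_integrable[OF integral(2)], of "?E t"] by simp
  show ?thesis
    unfolding delay_formula_def matrix_vector_right_distrib int1 int2
    by (simp add: matrix_vector_mul_assoc mexp_zero)
qed

lemma ddae_solution_explicit:
  fixes A B :: "complex^'n::finite^'n"
  assumes tau: "\<tau> > 0" and AB: "A ** B = B ** A"
    and \<phi>: "continuous_on UNIV \<phi>" and f: "continuous_on UNIV f"
    and x: "ddae_solution (mat 1) A B \<tau> f \<phi> x" and t: "t \<ge> 0"
  defines "Bh \<equiv> mexp ((- \<tau>) *\<^sub>R A) ** B"
  shows "x t = (mexp (t *\<^sub>R A) ** delay_exp \<tau> Bh (t - \<tau>)) *v \<phi> 0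
    + integral {-\<tau>..0} (\<lambda>s. (mexp ((t - s) *\<^sub>R A) ** delay_exp \<tau> Bh (t - 2 * \<tau> - s) ** Bh) *v \<phi> s)
    + integral {0..t} (\<lambda>s. (mexp ((t - s) *\<^sub>R A) ** delay_exp \<tau> Bh (t - \<tau> - s)) *v f s)"
proof -
  have "x t = mexp (t *\<^sub>R A) *v (mexp ((- t) *\<^sub>R A) *v x t)"
    using mexp_add[of t A "- t"] by (simp add: matrix_vector_mul_assoc mexp_zero)
  also have "\<dots> = mexp (t *\<^sub>R A) *v delay_formula \<tau> Bh
      (\<lambda>s. mexp ((- s) *\<^sub>R A) *v \<phi> s) (\<lambda>s. mexp ((- s) *\<^sub>R A) *v f s) t"
    unfolding Bh_def ddae_solution_variation_of_constants[OF tau AB \<phi> f x t] ..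
  also have "\<dots> = (mexp (t *\<^sub>R A) ** delay_exp \<tau> Bh (t - \<tau>)) *v \<phi> 0
    + integral {-\<tau>..0} (\<lambda>s. (mexp ((t - s) *\<^sub>R A) ** delay_exp \<tau> Bh (t - 2 * \<tau> - s) ** Bh) *v \<phi> s)
    + integral {0..t} (\<lambda>s. (mexp ((t - s) *\<^sub>R A) ** delay_exp \<tau> Bh (t - \<tau> - s)) *v f s)"
    unfolding Bh_def by (rule mexp_mult_delay_formula[OF tau AB \<phi> f t])
  finally show ?thesis .
qed

section \<open>Block-diagonal systems\<close>

lemma ddae_solution_transform:
  assumes x: "ddae_solution E A B \<tau> f \<phi> x"
    and L: "bounded_linear L" and R: "bounded_linear R"
    and E: "\<And>v. L (E *v v) = E' *v R v" and A: "\<And>v. L (A *v v) = A' *v R v"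
    and B: "\<And>v. L (B *v v) = B' *v R v"
  shows "ddae_solution E' A' B' \<tau> (\<lambda>s. L (f s)) (\<lambda>s. R (\<phi> s)) (\<lambda>s. R (x s))"
  unfolding ddae_solution_def
proof (intro conjI allI impI ballI)
  show "continuous_on {-\<tau>..} (\<lambda>s. R (x s))"
    by (rule bounded_linear.continuous_on[OF R ddae_solutionD(1)[OF x]])
  show "R (x t) = R (\<phi> t)" if "t \<in> {-\<tau>..0}" for t
    using ddae_solutionD(2)[OF x that] by simp
  show "\<exists>g. continuous_on {real j * \<tau>..(real j + 1) * \<tau>} g \<and>
      (\<forall>t\<in>{real j * \<tau><..<(real j + 1) * \<tau>}.
        ((\<lambda>s. E' *v R (x s)) has_vector_derivative g t) (at t))" for j
  proof -
    obtain g where "continuous_on {real j * \<tau>..(real j + 1) * \<tau>} g"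
      "\<forall>t\<in>{real j * \<tau><..<(real j + 1) * \<tau>}. ((\<lambda>s. E *v x s) has_vector_derivative g t) (at t)"
      using x unfolding ddae_solution_def by blast
    then show ?thesis
      by (intro exI[of _ "\<lambda>t. L (g t)"])
        (auto intro: bounded_linear.continuous_on[OF L] simp: E[symmetric]
          bounded_linear.has_vector_derivative[OF L])
  qed
  fix t :: real assume "t \<ge> 0" "\<forall>j::nat. t \<noteq> real j * \<tau>"
  from bounded_linear.has_vector_derivative[OF L ddae_solutionD(3)[OF x this]]
  show "((\<lambda>s. E' *v R (x s)) has_vector_derivative
      A' *v R (x t) + B' *v R (x (t - \<tau>)) + L (f t)) (at t)"
    by (simp add: E[symmetric] A[symmetric] B[symmetric] linear_add[OF bounded_linear.linear[OF L]])
qed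

lemma ddae_solution_premultiply:
  "ddae_solution E A B \<tau> f \<phi> x \<Longrightarrow>
    ddae_solution (M ** E) (M ** A) (M ** B) \<tau> (\<lambda>s. M *v f s) \<phi> (x::real \<Rightarrow> complex^'n::finite)"
  using ddae_solution_transform[of E A B \<tau> f \<phi> x "(*v) M" "\<lambda>v. v" "M ** E" "M ** A" "M ** B"]
  by (simp add: matrix_vector_mul_assoc bounded_linear_ident)

lemma sum_UNIV_sum_type:
  "sum g (UNIV :: ('a::finite + 'b::finite) set) = (\<Sum>a\<in>UNIV. g (Inl a)) + (\<Sum>b\<in>UNIV. g (Inr b))"
  using sum.Plus[of "UNIV::'a set" "UNIV::'b set" g] by (simp add: o_def)

lemma blk_matrix_vector_mult:
  fixes v :: "'r::comm_semiring_1^('a::finite + 'b::finite + 'c::finite)"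
  shows "blk1 (blkdiag3 M1 M2 M3 *v v) = M1 *v blk1 v"
    and "blk2 (blkdiag3 M1 M2 M3 *v v) = M2 *v blk2 v"
    and "blk3 (blkdiag3 M1 M2 M3 *v v) = M3 *v blk3 v"
  by (simp_all add: vec_eq_iff blk1_def blk2_def blk3_def blkdiag3_def matrix_vector_mult_def
      sum_UNIV_sum_type)

lemma bounded_linear_blk:
  "bounded_linear (blk1 :: complex^('a::finite + 'b::finite + 'c::finite) \<Rightarrow> _)"
  "bounded_linear (blk2 :: complex^('a::finite + 'b::finite + 'c::finite) \<Rightarrow> _)"
  "bounded_linear (blk3 :: complex^('a::finite + 'b::finite + 'c::finite) \<Rightarrow> _)"
  by (simp_all add: linear_conv_bounded_linear[symmetric] linear_iff vec_eq_iff blk1_def blk2_def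
      blk3_def)

lemma ddae_solution_blk:
  assumes "ddae_solution (blkdiag3 E1 E2 E3) (blkdiag3 A1 A2 A3) (blkdiag3 B1 B2 B3) \<tau> f \<phi> x"
  shows "ddae_solution E1 A1 B1 \<tau> (\<lambda>s. blk1 (f s)) (\<lambda>s. blk1 (\<phi> s)) (\<lambda>s. blk1 (x s))"
    and "ddae_solution E2 A2 B2 \<tau> (\<lambda>s. blk2 (f s)) (\<lambda>s. blk2 (\<phi> s)) (\<lambda>s. blk2 (x s))"
    and "ddae_solution E3 A3 B3 \<tau> (\<lambda>s. blk3 (f s)) (\<lambda>s. blk3 (\<phi> s)) (\<lambda>s. blk3 (x s))"
  by (rule ddae_solution_transform[OF assms bounded_linear_blk(1) bounded_linear_blk(1)]
      ddae_solution_transform[OF assms bounded_linear_blk(2) bounded_linear_blk(2)]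
      ddae_solution_transform[OF assms bounded_linear_blk(3) bounded_linear_blk(3)];
      simp add: blk_matrix_vector_mult)+

lemma blkdiag3_mult:
  fixes M1 N1 :: "'r::comm_semiring_1^'a::finite^'a" and M2 N2 :: "'r^'b::finite^'b"
    and M3 N3 :: "'r^'c::finite^'c"
  shows "blkdiag3 M1 M2 M3 ** blkdiag3 N1 N2 N3 = blkdiag3 (M1 ** N1) (M2 ** N2) (M3 ** N3)"
  by (simp add: vec_eq_iff blkdiag3_def matrix_matrix_mult_def sum_UNIV_sum_type split: sum.splits)

lemma blkdiag3_eq_iff:
  fixes M1 N1 :: "'r::zero^'a::finite^'a" and M2 N2 :: "'r^'b::finite^'b"
    and M3 N3 :: "'r^'c::finite^'c"
  shows "blkdiag3 M1 M2 M3 = blkdiag3 N1 N2 N3 \<longleftrightarrow> M1 = N1 \<and> M2 = N2 \<and> M3 = N3"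
proof
  assume "blkdiag3 M1 M2 M3 = blkdiag3 N1 N2 N3"
  then have e: "blkdiag3 M1 M2 M3 $ i $ j = blkdiag3 N1 N2 N3 $ i $ j" for i j by simp
  show "M1 = N1 \<and> M2 = N2 \<and> M3 = N3"
    using e[of "Inl _" "Inl _"] e[of "Inr (Inl _)" "Inr (Inl _)"] e[of "Inr (Inr _)" "Inr (Inr _)"]
    by (simp add: vec_eq_iff blkdiag3_def)
qed simp

lemma blkdiag3_commute:
  fixes M1 N1 :: "'r::comm_semiring_1^'a::finite^'a" and M2 N2 :: "'r^'b::finite^'b"
    and M3 N3 :: "'r^'c::finite^'c"
  shows "blkdiag3 M1 M2 M3 ** blkdiag3 N1 N2 N3 = blkdiag3 N1 N2 N3 ** blkdiag3 M1 M2 M3 \<longleftrightarrow>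
    M1 ** N1 = N1 ** M1 \<and> M2 ** N2 = N2 ** M2 \<and> M3 ** N3 = N3 ** M3"
  by (simp add: blkdiag3_mult blkdiag3_eq_iff)

lemma smooth_fun_blk:
  fixes f :: "real \<Rightarrow> complex^('a::finite + 'b::finite + 'c::finite)"
  assumes "smooth_fun f"
  shows "smooth_fun (\<lambda>s. blk1 (f s))" "smooth_fun (\<lambda>s. blk2 (f s))" "smooth_fun (\<lambda>s. blk3 (f s))"
  using smooth_fun_bounded_linear[OF bounded_linear_blk(1) assms]
    smooth_fun_bounded_linear[OF bounded_linear_blk(2) assms]
    smooth_fun_bounded_linear[OF bounded_linear_blk(3) assms] by simp_all

corollary ddae_solution_differential_block:
  fixes J A B :: "complex^'n::finite^'n"
  assumes tau: "\<tau> > 0" and J: "invertible J"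
    and comm: "J ** A = A ** J" "J ** B = B ** J" "A ** B = B ** A"
    and \<phi>: "smooth_fun \<phi>" and f: "smooth_fun f" and x: "ddae_solution J A B \<tau> f \<phi> x" and t: "t \<ge> 0"
  defines "At \<equiv> matrix_inv J ** A" and "Bh \<equiv> mexp ((- \<tau>) *\<^sub>R (matrix_inv J ** A)) ** (matrix_inv J ** B)"
  shows "x t = (mexp (t *\<^sub>R At) ** delay_exp \<tau> Bh (t - \<tau>)) *v \<phi> 0
    + integral {-\<tau>..0} (\<lambda>s. (mexp ((t - s) *\<^sub>R At) ** delay_exp \<tau> Bh (t - 2 * \<tau> - s) ** Bh) *v \<phi> s)
    + integral {0..t} (\<lambda>s. (mexp ((t - s) *\<^sub>R At) ** delay_exp \<tau> Bh (t - \<tau> - s))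
        *v (matrix_inv J *v f s))"
  unfolding At_def Bh_def
  by (rule ddae_solution_explicit[OF tau matrix_inv_mult_commute[OF J comm]
        smooth_fun_continuous_on[OF \<phi>]
        smooth_fun_continuous_on[OF smooth_fun_matrix_vector_mult[OF f]] _ t])
    (use ddae_solution_premultiply[OF x, of "matrix_inv J"] in \<open>simp add: matrix_inv_left[OF J]\<close>)

corollary ddae_solution_nilpotent_block:
  fixes J N B :: "complex^'n::finite^'n"
  assumes tau: "\<tau> > 0" and J: "invertible J" and JN: "J ** N = N ** J" and N: "nilpotent_mat N"
    and f: "smooth_fun f" and \<phi>: "smooth_fun \<phi>" and x: "ddae_solution N J B \<tau> f \<phi> x" and t: "t \<ge> 0"
  shows "x t = - (\<Sum>i<nilpotency_index (matrix_inv J ** N). mpow (matrix_inv J ** N) i *v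
    ((matrix_inv J ** B) *v rderiv i x (t - \<tau>) + nderiv i (\<lambda>s. matrix_inv J *v f s) t))"
  by (rule ddae_solution_nilpotent[OF tau nilpotent_mat_mult_commuting[OF matrix_inv_commute[OF J JN] N]
        smooth_fun_matrix_vector_mult[OF f] \<phi> _ t])
    (use ddae_solution_premultiply[OF x, of "matrix_inv J"] in \<open>simp add: matrix_inv_left[OF J]\<close>)

corollary ddae_solution_algebraic_block:
  fixes J N A :: "complex^'n::finite^'n"
  assumes tau: "\<tau> > 0" and J: "invertible J"
    and comm: "J ** N = N ** J" "J ** A = A ** J" "N ** A = A ** N"
    and nil: "nilpotent_mat N" "nilpotent_mat A"
    and f: "smooth_fun f" and x: "ddae_solution N A J \<tau> f \<phi> x" and t: "t \<ge> -\<tau>"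
  defines "L \<equiv> \<lambda>g s. (matrix_inv J ** N) *v vector_derivative g (at s) - (matrix_inv J ** A) *v g s"
  shows "x t = - (\<Sum>i<CARD('n). (L ^^ i) (\<lambda>s. matrix_inv J *v f s) (t + (real i + 1) * \<tau>))"
proof -
  have L_eq: "L = diff_op (matrix_inv J ** N) (matrix_inv J ** A)"
    by (simp add: L_def fun_eq_iff diff_op_def)
  show ?thesis
    unfolding L_eq
    by (rule ddae_solution_commuting_nilpotent[OF tau matrix_inv_mult_commute[OF J comm]
        nilpotent_mat_mult_commuting[OF matrix_inv_commute[OF J comm(1)] nil(1)]
        nilpotent_mat_mult_commuting[OF matrix_inv_commute[OF J comm(2)] nil(2)]
        smooth_fun_matrix_vector_mult[OF f] _ t])
    (use ddae_solution_premultiply[OF x, of "matrix_inv J"] in \<open>simp add: matrix_inv_left[OF J]\<close>)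
qed

theorem theorem6:
  fixes \<tau> :: real
    and JE A1 B1 :: "complex^'a^'a"
    and NE2 JA B2 :: "complex^'b^'b"
    and NE3 NA3 JB :: "complex^'c^'c"
    and E A B :: "complex^('a+'b+'c)^('a+'b+'c)"
    and f \<phi> x :: "real \<Rightarrow> complex^('a+'b+'c)"
  assumes tau: "\<tau> > 0"
    and E_def: "E = blkdiag3 JE NE2 NE3"
    and A_def: "A = blkdiag3 A1 JA NA3"
    and B_def: "B = blkdiag3 B1 B2 JB"
    and comm: "E ** A = A ** E" "E ** B = B ** E" "A ** B = B ** A"
    and reg: "regular_triple E A B"
    and inv: "invertible JE" "invertible JA" "invertible JB"
    and nil: "nilpotent_mat NE2" "nilpotent_mat NE3" "nilpotent_mat NA3"
    and uniq: "uniquely_solvable E A B \<tau> f \<phi>"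
    and smooth: "smooth_fun f" "smooth_fun \<phi>"
    and sol: "ddae_solution E A B \<tau> f \<phi> x"
  defines "At1 \<equiv> matrix_inv JE ** A1"
    and "Bt1 \<equiv> matrix_inv JE ** B1"
    and "ft1 \<equiv> (\<lambda>s. matrix_inv JE *v blk1 (f s))"
    and "Bh1 \<equiv> mexp ((- \<tau>) *\<^sub>R (matrix_inv JE ** A1)) ** (matrix_inv JE ** B1)"
    and "NEt2 \<equiv> matrix_inv JA ** NE2"
    and "Bt2 \<equiv> matrix_inv JA ** B2"
    and "ft2 \<equiv> (\<lambda>s. matrix_inv JA *v blk2 (f s))"
    and "NEt3 \<equiv> matrix_inv JB ** NE3"
    and "NAt3 \<equiv> matrix_inv JB ** NA3"
    and "ft3 \<equiv> (\<lambda>s. matrix_inv JB *v blk3 (f s))"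
    and "\<zeta> \<equiv> nilpotency_index (matrix_inv JA ** NE2)"
    and "L3 \<equiv> (\<lambda>g::real \<Rightarrow> complex^'c. \<lambda>s. (matrix_inv JB ** NE3) *v vector_derivative g (at s) - (matrix_inv JB ** NA3) *v g s)"
  shows "\<forall>t\<ge>0.
      blk1 (x t) =
        (mexp (t *\<^sub>R At1) ** delay_exp \<tau> Bh1 (t - \<tau>)) *v blk1 (\<phi> 0)
        + integral {-\<tau>..0} (\<lambda>s. (mexp ((t - s) *\<^sub>R At1) ** delay_exp \<tau> Bh1 (t - 2 * \<tau> - s) ** Bh1)
                                      *v blk1 (\<phi> s))
        + integral {0..t} (\<lambda>s. (mexp ((t - s) *\<^sub>R At1) ** delay_exp \<tau> Bh1 (t - \<tau> - s)) *v ft1 s)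
    \<and> blk2 (x t) =
        - (\<Sum>i<\<zeta>. mpow NEt2 i *v
              (Bt2 *v rderiv i (\<lambda>s. blk2 (x s)) (t - \<tau>) + nderiv i ft2 t))
    \<and> blk3 (x t) =
        - (\<Sum>i<CARD('c). (L3 ^^ i) ft3 (t + (real i + 1) * \<tau>))"
proof -
  note sol_blk = ddae_solution_blk[OF sol[unfolded E_def A_def B_def]]
  have "JE ** A1 = A1 ** JE" "JA ** NE2 = NE2 ** JA" "NE3 ** NA3 = NA3 ** NE3"
    "JE ** B1 = B1 ** JE" "JB ** NE3 = NE3 ** JB" "A1 ** B1 = B1 ** A1" "JB ** NA3 = NA3 ** JB"
    using comm by (auto simp: E_def A_def B_def blkdiag3_commute)
  then show ?thesis
    unfolding At1_def Bh1_def ft1_def NEt2_def Bt2_def ft2_def \<zeta>_def L3_def ft3_def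
    using ddae_solution_differential_block[OF tau inv(1) _ _ _ smooth_fun_blk(1)[OF smooth(2)]
        smooth_fun_blk(1)[OF smooth(1)] sol_blk(1)]
      ddae_solution_nilpotent_block[OF tau inv(2) _ nil(1) smooth_fun_blk(2)[OF smooth(1)]
        smooth_fun_blk(2)[OF smooth(2)] sol_blk(2)]
      ddae_solution_algebraic_block[OF tau inv(3) _ _ _ nil(2,3) smooth_fun_blk(3)[OF smooth(1)]
        sol_blk(3)]
      tau by auto
qed

end
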